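(* Let $n\ge 2$ be a fixed integer. Uniformly over $\delta\in\mathbb{Q}$, as $H\to\infty$, \[ \#\mathcal{D}_n(\mathbb{Q};H,\delta) \le \begin{cases} H^{4+o(1)}, & \text{if } n=2,\\ H^{2n^2-n+o(1)}, & \text{if } n\ge 3.\end{cases} \]
   Context: For a real $H\ge 1$, let $\mathcal{F}(H)=\{a/b:\ a,b\in\mathbb{Z},\ 0\le |a|,b\le H,\ \gcd(a,b)=1\}$. Let $\mathcal{M}_{n,n}(\mathbb{Q};H)$ be the set of $n\times n$ matrices with all entries in $\mathcal{F}(H)$, and for $\delta\in\mathbb{Q}$ let $\mathcal{D}_n(\mathbb{Q};H,\delta)=\{A\in\mathcal{M}_{n,n}(\mathbb{Q};H):\ \det A=\delta\}$. A bound $X\le H^{c+o(1)}$ uniformly over $\delta$ means: for every $\varepsilon>0$ there is $H_0$ (depending on $\varepsilon$ and $n$ only) such that $X\le H^{c+\varepsilon}$ for all $H\ge H_0$ and all $\delta\in\mathbb{Q}$. *)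

theory Defs
  imports Complex_Main "Jordan_Normal_Form.Determinant"
begin

(* The denominator b is taken to be positive: a / 0 does not denote a rational number. *)
definition height_fractions :: "real \<Rightarrow> rat set" where
  "height_fractions H =
    {of_int a / of_int b | a b :: int.
      \<bar>real_of_int a\<bar> \<le> H \<and> 0 < b \<and> real_of_int b \<le> H \<and> coprime a b}"

definition height_mats :: "nat \<Rightarrow> real \<Rightarrow> rat mat set" where
  "height_mats n H =
    {A \<in> carrier_mat n n. \<forall>i<n. \<forall>j<n. A $$ (i, j) \<in> height_fractions H}"

definition height_det_mats :: "nat \<Rightarrow> real \<Rightarrow> rat \<Rightarrow> rat mat set" where
  "height_det_mats n H \<delta> = {A \<in> height_mats n H. det A = \<delta>}"

lemma finite_height_fractions: "finite (height_fractions H)"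
proof -
  let ?I = "{- \<lceil>H\<rceil>..\<lceil>H\<rceil>} :: int set"
  have "height_fractions H \<subseteq> (\<lambda>(a, b). of_int a / of_int b) ` (?I \<times> ?I)"
  proof
    fix x assume "x \<in> height_fractions H"
    then obtain a b :: int where x: "x = of_int a / of_int b"
      and ab: "\<bar>real_of_int a\<bar> \<le> H" "0 < b" "real_of_int b \<le> H"
      unfolding height_fractions_def by blast
    have "a \<in> ?I" "b \<in> ?I" using ab by (simp; linarith)+
    then show "x \<in> (\<lambda>(a, b). of_int a / of_int b) ` (?I \<times> ?I)" using x by auto
  qed
  then show ?thesis by (rule finite_subset) simp
qed

(* Without finiteness, "card" of the set below would be 0 by convention. *)
lemma finite_height_det_mats: "finite (height_det_mats n H \<delta>)"
proof -
  let ?P = "{..<n} \<times> {..<n}"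
  let ?E = "\<lambda>A :: rat mat. restrict (\<lambda>ij. A $$ ij) ?P"
  have "inj_on ?E (carrier_mat n n)"
  proof (rule inj_onI)
    fix A B :: "rat mat"
    assume AB: "A \<in> carrier_mat n n" "B \<in> carrier_mat n n" and eq: "?E A = ?E B"
    have "A $$ (i, j) = B $$ (i, j)" if "i < n" "j < n" for i j
      using fun_cong[OF eq, of "(i, j)"] that by simp
    then show "A = B" using AB by (intro eq_matI) auto
  qed
  then have inj: "inj_on ?E (height_mats n H)"
    by (rule inj_on_subset) (auto simp: height_mats_def)
  have "?E ` height_mats n H \<subseteq> ?P \<rightarrow>\<^sub>E height_fractions H"
    by (auto simp: height_mats_def split: if_splits)
  moreover have "finite (?P \<rightarrow>\<^sub>E height_fractions H)"
    by (intro finite_PiE) (simp_all add: finite_height_fractions)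
  ultimately have "finite (height_mats n H)"
    using inj by (meson finite_imageD finite_subset)
  then show ?thesis
    by (rule rev_finite_subset) (auto simp: height_det_mats_def)
qed

end

theory Submission
  imports Defs
begin

text \<open>
  For integers \<open>s\<^sub>1, \<dots>, s\<^sub>k\<close> of polynomial size, all nonzero, the equation \<open>s\<^sub>1 x\<^sub>1 + \<dots> + s\<^sub>k x\<^sub>k = e\<close> has at most
  \<open>H\<^bsup>k+o(1)\<^esup> / den e\<close> solutions in fractions of height at most \<open>H\<close>: removing one variable replaces \<open>e\<close> by
  \<open>e - s x\<close>, and the divisor bound shows that the average of \<open>1 / den (e - s x)\<close> over \<open>x\<close> is at most
  \<open>H\<^bsup>-1+o(1)\<^esup> / den e\<close>.

  Expand the determinant along a row. If all its cofactors are nonzero, there are \<open>H\<^bsup>n+o(1)\<^esup>\<close> choices for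
  the row, which saves \<open>n\<close> in the exponent. If some cofactor vanishes, induction on \<open>n\<close> saves
  \<open>n - 1\<close> from the corresponding minor, and the row saves at least 1 more: through a nonzero cofactor,
  or, when all cofactors vanish, because the row can be chosen in the span of the others and is then
  orthogonal to a fixed nonzero vector.

  For \<open>n = 2\<close> the Cauchy-Schwarz inequality reduces \<open>x y - z w = \<delta>\<close> to \<open>x y = z w\<close>, which the divisor
  bound controls directly.
\<close>

section \<open>Divisor counts\<close>

text \<open>Every divisor of the product splits into a divisor of each factor, and
  \<open>p ^ k\<close> has the \<open>k + 1\<close> divisors \<open>p ^ i\<close>.\<close>

lemma card_divisors_prime_power_mult:
  fixes p k m :: nat
  assumes "prime p" "m > 0"
  shows "card {d. d dvd p ^ k * m} \<le> (k + 1) * card {d. d dvd m}"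
proof -
  have "{d. d dvd p ^ k * m} \<subseteq> (\<lambda>(i, d). p ^ i * d) ` ({..k} \<times> {d. d dvd m})"
  proof
    fix d assume "d \<in> {d. d dvd p ^ k * m}"
    then obtain x y where xy: "d = x * y" "x dvd p ^ k" "y dvd m"
      using dvd_productE[of d "p ^ k" m] by auto
    obtain i where "i \<le> k" "x = p ^ i"
      using xy(2) assms(1) divides_primepow_nat by auto
    with xy show "d \<in> (\<lambda>(i, d). p ^ i * d) ` ({..k} \<times> {d. d dvd m})" by auto
  qed
  then have "card {d. d dvd p ^ k * m} \<le> card ({..k} \<times> {d. d dvd m})"
    using assms by (intro surj_card_le) auto
  then show ?thesis by (simp add: card_cartesian_product)
qed

text \<open>The exact prime powers \<open>p ^ k\<close> in \<open>n\<close> are peeled off one at a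
  time. If \<open>p \<ge> P\<close>, then \<open>k + 1 \<le> 2 ^ k\<close> is already at most
  \<open>(p ^ k) powr \<epsilon>\<close>; each smaller prime costs a factor \<open>c\<close>, and
  fewer than \<open>P\<close> such primes exist.\<close>

lemma divisor_bound_nat:
  fixes \<epsilon> :: real
  assumes "\<epsilon> > 0"
  shows "\<exists>C>0. \<forall>n::nat. n > 0 \<longrightarrow> real (card {d. d dvd n}) \<le> C * real n powr \<epsilon>"
proof -
  \<comment> \<open>Chosen so that \<open>c * \<epsilon> * ln 2 \<ge> 1\<close>; then
    \<open>k + 1\<close> stays below \<open>c\<close> times the linear lower bound for the
    exponential.\<close>
  define c where "c = max 1 (1 / (\<epsilon> * ln 2))"
  have c1: "c \<ge> 1" by (simp add: c_def)
  have c: "real k + 1 \<le> c * (2 ^ k) powr \<epsilon>" for k :: nat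
  proof -
    have "real k + 1 \<le> c * (1 + real k * \<epsilon> * ln 2)"
    proof -
      have "c * (\<epsilon> * ln 2) \<ge> (1 / (\<epsilon> * ln 2)) * (\<epsilon> * ln 2)"
        using assms by (intro mult_right_mono) (auto simp: c_def)
      then have "c * (\<epsilon> * ln 2) \<ge> 1" using assms by simp
      then have "real k * (c * (\<epsilon> * ln 2)) \<ge> real k * 1" by (intro mult_left_mono) auto
      then show ?thesis using c1 by (simp add: algebra_simps)
    qed
    also have "1 + real k * \<epsilon> * ln 2 \<le> exp (real k * \<epsilon> * ln 2)" by (rule exp_ge_add_one_self)
    also have "exp (real k * \<epsilon> * ln 2) = (2 ^ k) powr \<epsilon>"
      by (simp add: powr_def ln_realpow algebra_simps)
    finally show ?thesis using c1 by (simp add: mult_left_mono)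
  qed
  \<comment> \<open>The threshold beyond which \<open>p powr \<epsilon> \<ge> 2\<close>.\<close>
  define P :: nat where "P = nat \<lceil>2 powr (1 / \<epsilon>)\<rceil>"
  have P: "2 \<le> real p powr \<epsilon>" if "P \<le> p" for p
  proof -
    have "2 powr (1 / \<epsilon>) \<le> real p" using that unfolding P_def by linarith
    then have "(2 powr (1 / \<epsilon>)) powr \<epsilon> \<le> real p powr \<epsilon>"
      using assms by (intro powr_mono2) auto
    then show ?thesis using assms by (simp add: powr_powr)
  qed
  \<comment> \<open>The primes that may cost a factor \<open>c\<close>; their number is bounded by
    \<open>P\<close> independently of \<open>n\<close>.\<close>
  define S where "S n = {p. prime p \<and> p dvd n \<and> p < P}" for n :: nat
  have finS: "finite (S n)" for n by (rule finite_subset[of _ "{..<P}"]) (auto simp: S_def)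
  have main: "n > 0 \<Longrightarrow> real (card {d. d dvd n}) \<le> c ^ card (S n) * real n powr \<epsilon>" for n :: nat
  proof (induction n rule: less_induct)
    case (less n)
    show ?case
    proof (cases "n = 1")
      case True
      then show ?thesis using c1 by simp
    next
      case False
      then obtain p where p: "prime p" "p dvd n" using prime_factor_nat by blast
      have "n \<noteq> 0" "\<not> is_unit p" using less.prems p(1) by auto
      then obtain k m where km: "n = p ^ k * m" "\<not> p dvd m"
        using multiplicity_decompose'[of n p] by metis
      have k: "k > 0" using p km by (cases k) auto
      have m: "m > 0" using less.prems km by auto
      have pk: "1 < p ^ k" using k prime_gt_1_nat[OF p(1)] by (intro one_less_power)
      then have "m < n" using km m by simp
      with less.IH m have IH: "real (card {d. d dvd m}) \<le> c ^ card (S m) * real m powr \<epsilon>" by blast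
      have p2: "real p \<ge> 2" using prime_ge_2_nat[OF p(1)] by simp
      have factor: "(real k + 1) * c ^ card (S m) \<le> c ^ card (S n) * real (p ^ k) powr \<epsilon>"
      proof (cases "p < P")
        case True
        have "insert p (S m) \<subseteq> S n" "p \<notin> S m"
          using True p km by (auto simp: S_def)
        then have "Suc (card (S m)) \<le> card (S n)"
          using finS by (metis card_insert_disjoint card_mono)
        then have "c ^ Suc (card (S m)) \<le> c ^ card (S n)"
          using c1 by (rule power_increasing)
        moreover have "(2 ^ k) powr \<epsilon> \<le> real (p ^ k) powr \<epsilon>"
          using assms p2 by (intro powr_mono2) (auto intro: power_mono)
        ultimately have "c ^ Suc (card (S m)) * (2 ^ k) powr \<epsilon> \<le> c ^ card (S n) * real (p ^ k) powr \<epsilon>"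
          using c1 by (intro mult_mono) auto
        moreover have "(real k + 1) * c ^ card (S m) \<le> (c * (2 ^ k) powr \<epsilon>) * c ^ card (S m)"
          using c[of k] c1 by (intro mult_right_mono) auto
        ultimately show ?thesis by (simp add: algebra_simps)
      next
        case False
        have "c ^ card (S m) \<le> c ^ card (S n)"
          using c1 finS km by (intro power_increasing card_mono) (auto simp: S_def)
        moreover have "real k + 1 \<le> real (p ^ k) powr \<epsilon>"
        proof -
          have "real k + 1 \<le> 2 ^ k"
          proof -
            have "k < 2 ^ k" by (rule less_exp)
            then have "k + 1 \<le> 2 ^ k" by linarith
            then have "real (k + 1) \<le> real (2 ^ k)" by (simp only: of_nat_le_iff)
            then show ?thesis by (simp add: add.commute)
          qed
          also have "\<dots> \<le> (real p powr \<epsilon>) ^ k" using P[of p] False by (intro power_mono) auto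
          also have "\<dots> = real (p ^ k) powr \<epsilon>"
            by (induction k) (simp_all add: powr_mult)
          finally show ?thesis .
        qed
        ultimately show ?thesis using c1
          by (subst mult.commute) (intro mult_mono, auto)
      qed
      have "real (card {d. d dvd n}) \<le> real ((k + 1) * card {d. d dvd m})"
        unfolding km using card_divisors_prime_power_mult[OF p(1) m] by (simp only: of_nat_le_iff)
      also have "\<dots> \<le> (real k + 1) * (c ^ card (S m) * real m powr \<epsilon>)"
        using mult_left_mono[OF IH, of "real k + 1"] by (simp add: algebra_simps)
      also have "\<dots> \<le> (c ^ card (S n) * real (p ^ k) powr \<epsilon>) * real m powr \<epsilon>"
        using mult_right_mono[OF factor, of "real m powr \<epsilon>"] by (simp add: mult.assoc)
      also have "\<dots> = c ^ card (S n) * real n powr \<epsilon>"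
        by (simp add: km powr_mult)
      finally show ?thesis .
    qed
  qed
  show ?thesis
  proof (intro exI[of _ "c ^ P"] conjI allI impI)
    show "c ^ P > 0" using c1 by simp
    fix n :: nat assume n: "n > 0"
    have "card (S n) \<le> card {..<P}" by (intro card_mono) (auto simp: S_def)
    then have "c ^ card (S n) \<le> c ^ P" using c1 by (intro power_increasing) auto
    then have "c ^ card (S n) * real n powr \<epsilon> \<le> c ^ P * real n powr \<epsilon>"
      by (intro mult_right_mono) auto
    with main[OF n] show "real (card {d. d dvd n}) \<le> c ^ P * real n powr \<epsilon>" by linarith
  qed
qed

lemma divisor_bound:
  fixes \<epsilon> :: real
  assumes "\<epsilon> > 0"
  shows "\<exists>C>0. \<forall>m::int. m \<noteq> 0 \<longrightarrow> real (card {d. d dvd m}) \<le> C * \<bar>real_of_int m\<bar> powr \<epsilon>"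
proof -
  obtain C where C: "C > 0" "\<And>n::nat. n > 0 \<Longrightarrow> real (card {d. d dvd n}) \<le> C * real n powr \<epsilon>"
    using divisor_bound_nat[OF assms] by blast
  have "real (card {d. d dvd m}) \<le> 2 * C * \<bar>real_of_int m\<bar> powr \<epsilon>" if m: "m \<noteq> 0" for m :: int
  proof -
    let ?D = "{d. d dvd nat \<bar>m\<bar>}"
    have fin: "finite ?D" using m by (intro finite_divisors_nat) simp
    have "{d. d dvd m} \<subseteq> int ` ?D \<union> (\<lambda>d. - int d) ` ?D"
    proof
      fix d assume "d \<in> {d. d dvd m}"
      then have "nat \<bar>d\<bar> \<in> ?D" by (simp add: nat_abs_dvd_iff)
      moreover have "d = int (nat \<bar>d\<bar>) \<or> d = - int (nat \<bar>d\<bar>)" by linarith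
      ultimately show "d \<in> int ` ?D \<union> (\<lambda>d. - int d) ` ?D" by blast
    qed
    then have "card {d. d dvd m} \<le> card (int ` ?D \<union> (\<lambda>d. - int d) ` ?D)"
      using fin by (intro card_mono) auto
    also have "\<dots> \<le> card (int ` ?D) + card ((\<lambda>d. - int d) ` ?D)" by (rule card_Un_le)
    also have "\<dots> \<le> card ?D + card ?D" using fin by (intro add_mono card_image_le)
    finally have "real (card {d. d dvd m}) \<le> 2 * real (card ?D)" by linarith
    also have "\<dots> \<le> 2 * (C * real (nat \<bar>m\<bar>) powr \<epsilon>)" using C(2)[of "nat \<bar>m\<bar>"] m by simp
    finally show ?thesis by simp
  qed
  then show ?thesis using C(1) by (intro exI[of _ "2 * C"]) auto
qed

section \<open>Numerators and denominators in lowest terms\<close>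

definition rat_num :: "rat \<Rightarrow> int" where
  "rat_num r = fst (quotient_of r)"

definition rat_den :: "rat \<Rightarrow> int" where
  "rat_den r = snd (quotient_of r)"

lemma rat_den_pos: "rat_den r > 0"
  by (simp add: rat_den_def quotient_of_denom_pos')

lemma coprime_num_den: "coprime (rat_num r) (rat_den r)"
  by (simp add: rat_num_def rat_den_def quotient_of_coprime)

lemma num_div_den: "of_int (rat_num r) / of_int (rat_den r) = r"
  unfolding rat_num_def rat_den_def by (rule quotient_of_div[symmetric]) simp

lemma num_den_divide:
  assumes "b > 0"
  shows "rat_num (of_int a / of_int b) = a div gcd a b"
    and "rat_den (of_int a / of_int b) = b div gcd a b"
proof -
  have "quotient_of (of_int a / of_int b) = (a div gcd a b, b div gcd a b)"
    using assms by (simp add: Fract_of_int_quotient[symmetric] quotient_of_Fract Rat.normalize_def Let_def)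
  then show "rat_num (of_int a / of_int b) = a div gcd a b" "rat_den (of_int a / of_int b) = b div gcd a b"
    by (simp_all add: rat_num_def rat_den_def)
qed

lemma rat_eqI:
  assumes "rat_num x = rat_num y" "rat_den x = rat_den y"
  shows "x = y"
proof -
  have "(of_int (rat_num x) / of_int (rat_den x) :: rat) = of_int (rat_num y) / of_int (rat_den y)"
    using assms by simp
  then show ?thesis by (simp only: num_div_den)
qed

text \<open>Reduced representations with positive denominator are unique, so the existential
  definition becomes a condition on the canonical numerator and denominator.\<close>

lemma height_fractions_iff:
  "x \<in> height_fractions H \<longleftrightarrow> \<bar>real_of_int (rat_num x)\<bar> \<le> H \<and> real_of_int (rat_den x) \<le> H"
proof
  assume "x \<in> height_fractions H"
  then obtain a b where ab: "x = of_int a / of_int b" "\<bar>real_of_int a\<bar> \<le> H" "0 < b" "real_of_int b \<le> H" "coprime a b"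
    by (auto simp: height_fractions_def)
  have "gcd a b = 1" using ab(5) by simp
  then show "\<bar>real_of_int (rat_num x)\<bar> \<le> H \<and> real_of_int (rat_den x) \<le> H"
    using ab by (simp add: num_den_divide del: coprime_iff_gcd_eq_1)
next
  assume "\<bar>real_of_int (rat_num x)\<bar> \<le> H \<and> real_of_int (rat_den x) \<le> H"
  then show "x \<in> height_fractions H"
    unfolding height_fractions_def using coprime_num_den[of x] rat_den_pos[of x]
    by (intro CollectI exI[of _ "rat_num x"] exI[of _ "rat_den x"] conjI) (auto simp: num_div_den)
qed

section \<open>The average of reciprocal denominators\<close>

text \<open>Measured from the least element, the members of \<open>A\<close> are multiples of
  \<open>m\<close> in an interval of length \<open>2 * H\<close>; the summand 1 accounts for the
  starting point.\<close>

lemma card_congruent_le: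
  fixes A :: "int set" and H :: real
  assumes A: "\<And>a. a \<in> A \<Longrightarrow> \<bar>real_of_int a\<bar> \<le> H" and "H \<ge> 0" "m > 0"
    and cong: "\<And>a b. a \<in> A \<Longrightarrow> b \<in> A \<Longrightarrow> m dvd a - b"
  shows "real (card A) \<le> 2 * H / real_of_int m + 1"
proof (cases "A = {}")
  case True
  then show ?thesis using \<open>H \<ge> 0\<close> \<open>m > 0\<close> by simp
next
  case False
  have fin: "finite A"
  proof (rule finite_subset)
    show "A \<subseteq> {- \<lceil>H\<rceil>..\<lceil>H\<rceil>}"
    proof
      fix a assume "a \<in> A"
      then show "a \<in> {- \<lceil>H\<rceil>..\<lceil>H\<rceil>}" using A[of a] by (simp; linarith)
    qed
  qed simp
  define a0 where "a0 = Min A"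
  have a0: "a0 \<in> A" "\<And>a. a \<in> A \<Longrightarrow> a0 \<le> a" using fin False by (auto simp: a0_def)
  define f where "f a = (a - a0) div m" for a
  have inj: "inj_on f A"
  proof (rule inj_onI)
    fix a b assume ab: "a \<in> A" "b \<in> A" "f a = f b"
    have "a - a0 = f a * m" "b - a0 = f b * m"
      using cong[OF ab(1) a0(1)] cong[OF ab(2) a0(1)] by (simp_all add: f_def)
    then have "a - a0 = b - a0" by (simp only: ab(3))
    then show "a = b" by simp
  qed
  have "f ` A \<subseteq> {0..\<lfloor>2 * H / real_of_int m\<rfloor>}"
  proof
    fix k assume "k \<in> f ` A"
    then obtain a where a: "a \<in> A" "k = f a" by auto
    have "f a * m = a - a0" using cong[OF a(1) a0(1)] by (simp add: f_def)
    then have "real_of_int (f a * m) = real_of_int (a - a0)" by simp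
    then have "real_of_int (f a) * real_of_int m = real_of_int a - real_of_int a0" by simp
    also have "\<dots> \<le> 2 * H" using A[OF a(1)] A[OF a0(1)] by linarith
    finally have "real_of_int (f a) \<le> 2 * H / real_of_int m" using \<open>m > 0\<close> by (simp add: field_simps)
    moreover have "f a \<ge> 0" using a0(2)[OF a(1)] \<open>m > 0\<close> by (simp add: f_def pos_imp_zdiv_nonneg_iff)
    ultimately show "k \<in> {0..\<lfloor>2 * H / real_of_int m\<rfloor>}" using a(2) by (simp add: le_floor_iff)
  qed
  then have "card A \<le> card {0..\<lfloor>2 * H / real_of_int m\<rfloor>}"
    by (intro card_inj_on_le[OF inj]) auto
  also have "card {0..\<lfloor>2 * H / real_of_int m\<rfloor>} = nat (\<lfloor>2 * H / real_of_int m\<rfloor> + 1)" by simp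
  finally have "real (card A) \<le> real (nat (\<lfloor>2 * H / real_of_int m\<rfloor> + 1))" by (simp only: of_nat_le_iff)
  also have "\<dots> = real_of_int \<lfloor>2 * H / real_of_int m\<rfloor> + 1"
    using \<open>H \<ge> 0\<close> \<open>m > 0\<close> by simp
  also have "\<dots> \<le> 2 * H / real_of_int m + 1" by simp
  finally show ?thesis .
qed

text \<open>Each new term satisfies \<open>1 / (k + 1) \<le> ln (k + 1) - ln k\<close>, from
  \<open>ln y \<le> y - 1\<close> at \<open>y = k / (k + 1)\<close>, and the differences
  telescope.\<close>

lemma sum_inverse_le_ln:
  assumes "H \<ge> 1"
  shows "(\<Sum>k\<in>{1..\<lfloor>H\<rfloor>}. 1 / real_of_int k) \<le> 1 + ln H"
proof -
  have *: "(\<Sum>k=1..Suc n. 1 / real k) \<le> 1 + ln (real (Suc n))" for n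
  proof (induction n)
    case (Suc n)
    have "ln (real (Suc n) / real (Suc (Suc n))) \<le> real (Suc n) / real (Suc (Suc n)) - 1"
      by (intro ln_le_minus_one) simp
    also have "\<dots> = - (1 / real (Suc (Suc n)))" by (simp add: field_simps)
    finally have "1 / real (Suc (Suc n)) \<le> ln (real (Suc (Suc n))) - ln (real (Suc n))"
      by (subst (asm) ln_div) (auto simp del: of_nat_Suc)
    then have "(\<Sum>k=1..Suc n. 1 / real k) + 1 / real (Suc (Suc n)) \<le> 1 + ln (real (Suc (Suc n)))"
      using Suc by linarith
    then show ?case by (simp del: of_nat_Suc)
  qed simp
  define n where "n = nat \<lfloor>H\<rfloor>"
  have n: "\<lfloor>H\<rfloor> = int n" "n \<ge> 1" using assms by (auto simp: n_def le_nat_iff le_floor_iff)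
  have "(\<Sum>k\<in>{1..\<lfloor>H\<rfloor>}. 1 / real_of_int k) = (\<Sum>k\<in>int ` {1..n}. 1 / real_of_int k)"
    by (simp add: n image_int_atLeastAtMost)
  also have "\<dots> = (\<Sum>k=1..n. 1 / real k)" by (subst sum.reindex) (auto simp: inj_on_def)
  also have "\<dots> \<le> 1 + ln (real n)" using *[of "n - 1"] n(2) by (simp only: Suc_diff_1)
  also have "\<dots> \<le> 1 + ln H"
  proof -
    have "real_of_int \<lfloor>H\<rfloor> \<le> H" by simp
    then have "real n \<le> H" unfolding n(1) by simp
    then show ?thesis using n(2) by (intro add_left_mono ln_mono) auto
  qed
  finally show ?thesis .
qed

text \<open>Removing \<open>d\<close> and then \<open>g\<close> writes
  \<open>u / v - s * (a / b)\<close> with numerator \<open>u * t - a * s' * w\<close> over the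
  common denominator \<open>t * v\<close>; \<open>m\<close> is all that still cancels. A common
  factor of \<open>m\<close> and \<open>w\<close> would divide \<open>u * t\<close>, and one of
  \<open>m\<close> and \<open>t\<close> would divide \<open>a * s' * w\<close>; coprimality of the
  reduced data allows only units, so \<open>m\<close> comes from \<open>g\<close> alone. Coprimality
  with \<open>s' * w\<close> later confines \<open>a\<close> to one class modulo
  \<open>m\<close>.\<close>

lemma den_diff_mult:
  fixes a b s u v :: int
  assumes "b > 0" "v > 0" "coprime a b" "coprime u v"
  defines "d \<equiv> gcd s b"
  defines "b' \<equiv> b div d" and "s' \<equiv> s div d"
  defines "g \<equiv> gcd b' v"
  defines "t \<equiv> b' div g" and "w \<equiv> v div g"
  defines "m \<equiv> gcd (u * t - a * s' * w) (t * v)"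
  shows "rat_den (of_int u / of_int v - of_int s * (of_int a / of_int b)) * m = t * v"
    and "m dvd g" and "coprime m (s' * w)"
proof -
  have d: "d > 0" using assms by (simp add: d_def)
  have b: "b = b' * d" and s: "s = s' * d" by (auto simp: b'_def s'_def d_def)
  have b'0: "b' > 0" using b d \<open>b > 0\<close> by (simp add: zero_less_mult_iff)
  have cop1: "coprime s' b'"
    unfolding s'_def b'_def d_def using \<open>b > 0\<close> by (intro div_gcd_coprime) auto
  have g: "g > 0" using b'0 by (simp add: g_def)
  have b': "b' = t * g" and v: "v = w * g" by (auto simp: t_def w_def g_def)
  have cop2: "coprime t w"
    unfolding t_def w_def g_def using \<open>v > 0\<close> by (intro div_gcd_coprime) auto
  have t0: "t > 0" using b' b'0 g by (simp add: zero_less_mult_iff)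
  have w0: "w > 0" using v g \<open>v > 0\<close> by (simp add: zero_less_mult_iff)
  have eq: "of_int u / of_int v - of_int s * (of_int a / of_int b)
        = (of_int (u * t - a * s' * w) / of_int (t * v) :: rat)"
    using d g t0 w0 unfolding b b' v s by (simp add: field_simps)
  have tv: "t * v > 0" using t0 \<open>v > 0\<close> by simp
  show "rat_den (of_int u / of_int v - of_int s * (of_int a / of_int b)) * m = t * v"
    unfolding eq num_den_divide(2)[OF tv] m_def by simp
  have mN: "m dvd u * t - a * s' * w" and mtv: "m dvd t * v" by (simp_all add: m_def)
  have mw: "coprime m w"
  proof (rule coprimeI)
    fix c assume c: "c dvd m" "c dvd w"
    have "c dvd (u * t - a * s' * w) + a * s' * w"
      using dvd_trans[OF c(1) mN] dvd_mult[OF c(2), of "a * s'"] by (rule dvd_add)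
    then have "c dvd u * t" by simp
    moreover have "coprime c u"
    proof (rule coprime_divisors)
      show "c dvd v" using c(2) v by simp
      show "coprime v u" using assms(4) by (simp add: coprime_commute)
    qed simp
    moreover have "coprime c t"
      using c(2) cop2 by (metis coprime_commute coprime_divisors dvd_refl)
    ultimately show "is_unit c"
      by (intro coprime_common_divisor[of c "u * t" c]) auto
  qed
  have mt: "coprime m t"
  proof (rule coprimeI)
    fix c assume c: "c dvd m" "c dvd t"
    have "c dvd u * t - (u * t - a * s' * w)"
      using dvd_mult[OF c(2), of u] dvd_trans[OF c(1) mN] by (rule dvd_diff)
    then have "c dvd a * s' * w" by simp
    moreover have "c dvd b'" using c(2) b' by simp
    then have "coprime c s'" "coprime c a"
      using cop1 assms(3) b coprime_divisors[of c b' s' s'] coprime_divisors[of c b a a]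
      by (simp_all add: coprime_commute)
    moreover have "coprime c w" using coprime_divisors[OF c(2) dvd_refl cop2] .
    ultimately show "is_unit c"
      by (intro coprime_common_divisor[of c "a * s' * w" c]) auto
  qed
  show mg: "m dvd g"
    using mtv mt mw unfolding v by (simp add: coprime_dvd_mult_right_iff)
  have "m dvd b'" using mg b' by simp
  then have "coprime m s'"
    using cop1 coprime_divisors[of m b' s' s'] by (simp add: coprime_commute)
  with mw show "coprime m (s' * w)" by simp
qed

text \<open>With \<open>v = rat_den e\<close>, the term at \<open>x\<close> equals
  \<open>m x / (t x * v)\<close> by \<open>den_diff_mult\<close>. Sorting \<open>x\<close> by
  \<open>(d, g, m, t)\<close> costs one divisor count of \<open>s\<close> and two of
  \<open>v\<close>; at most \<open>3 * H / m\<close> fractions share given values, which cancels the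
  weight \<open>m\<close>, and the remaining \<open>1 / t\<close> sums to a logarithm.\<close>

lemma sum_inverse_den_le:
  fixes H :: real and s :: int and e :: rat
  assumes H: "H \<ge> 1" and s: "s \<noteq> 0"
  shows "(\<Sum>x\<in>height_fractions H. 1 / real_of_int (rat_den (e - of_int s * x)))
    \<le> real (card {k. k dvd s}) * (real (card {k. k dvd rat_den e}))\<^sup>2 * (3 * H * (1 + ln H)) / real_of_int (rat_den e)"
proof -
  let ?F = "height_fractions H"
  define u v where "u = rat_num e" and "v = rat_den e"
  have v: "v > 0" and uv: "coprime u v" and e: "e = of_int u / of_int v"
    by (simp_all add: u_def v_def rat_den_pos coprime_num_den num_div_den)
  define d where "d x = gcd s (rat_den x)" for x
  define b' where "b' x = rat_den x div d x" for x
  define s' where "s' x = s div d x" for x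
  define g where "g x = gcd (b' x) v" for x
  define t where "t x = b' x div g x" for x
  define w where "w x = v div g x" for x
  define m where "m x = gcd (u * t x - rat_num x * s' x * w x) (t x * v)" for x
  have defs: "rat_den (e - of_int s * x) * m x = t x * v" "m x dvd g x" "coprime (m x) (s' x * w x)" for x
    using den_diff_mult[where s = s, OF rat_den_pos[of x] v coprime_num_den uv, folded e, unfolded num_div_den]
    unfolding d_def b'_def s'_def g_def t_def w_def m_def by auto
  have dpos: "d x > 0" and gpos: "g x > 0" for x
    using s v by (auto simp: d_def g_def)
  have den: "rat_den x = t x * g x * d x" for x
    by (simp add: t_def g_def b'_def d_def)
  have tpos: "t x > 0" for x
    using den[of x] rat_den_pos[of x] gpos[of x] dpos[of x] by (simp add: zero_less_mult_iff)
  have mpos: "m x > 0" for x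
    using tpos[of x] v by (simp add: m_def)
  define Y where "Y = {k. k dvd s} \<times> {k. k dvd v} \<times> {k. k dvd v} \<times> {1..\<lfloor>H\<rfloor>}"
  have finY: "finite Y" using s v by (simp add: Y_def)
  \<comment> \<open>Once these four integers are fixed, \<open>x\<close> is determined by its numerator, which is confined to one
    residue class modulo \<open>m x\<close>.\<close>
  define h where "h x = (d x, g x, m x, t x)" for x
  have tle: "t x \<le> rat_den x" "g x \<le> rat_den x" for x
    using den[of x] rat_den_pos[of x] by (auto intro!: zdvd_imp_le)
  have hY: "h ` ?F \<subseteq> Y"
  proof
    fix y assume "y \<in> h ` ?F"
    then obtain x where x: "x \<in> ?F" "y = h x" by auto
    have "real_of_int (t x) \<le> H"
      using x(1) tle(1)[of x] unfolding height_fractions_iff by linarith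
    moreover have "g x dvd v" by (simp add: g_def)
    moreover have "m x dvd v" using defs(2)[of x] \<open>g x dvd v\<close> by (rule dvd_trans)
    moreover have "d x dvd s" by (simp add: d_def)
    ultimately show "y \<in> Y" using tpos[of x] x(2) by (auto simp: Y_def h_def le_floor_iff)
  qed
  define fib where "fib y = {x \<in> ?F. h x = y}" for y
  have fib: "(\<Sum>x\<in>fib (d0, g0, m0, t0). 1 / real_of_int (rat_den (e - of_int s * x)))
      \<le> 3 * H / real_of_int v * (1 / real_of_int t0)" if "(d0, g0, m0, t0) \<in> Y" for d0 g0 m0 t0
  proof (cases "fib (d0, g0, m0, t0) = {}")
    case True
    then show ?thesis using H v that by (simp add: Y_def)
  next
    case False
    then obtain x0 where x0: "x0 \<in> ?F" "d x0 = d0" "g x0 = g0" "m x0 = m0" "t x0 = t0"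
      by (auto simp: fib_def h_def)
    have m0: "m0 > 0" and t0: "t0 > 0" using mpos[of x0] tpos[of x0] x0 by auto
    \<comment> \<open>Since \<open>m0\<close> is at most \<open>H\<close>, the extra 1 in the
      residue class count is absorbed: \<open>2 * H / m0 + 1 \<le> 3 * H / m0\<close>.\<close>
    have "m0 \<le> g0" using defs(2)[of x0] gpos[of x0] x0 by (auto intro: zdvd_imp_le)
    then have m0H: "real_of_int m0 \<le> H"
      using x0(1,3) tle(2)[of x0] unfolding height_fractions_iff by linarith
    have fx: "rat_den x = t0 * g0 * d0" "s' x = s' x0" "w x = w x0" "m x = m0" "t x = t0"
      "\<bar>real_of_int (rat_num x)\<bar> \<le> H" if "x \<in> fib (d0, g0, m0, t0)" for x
      using that den[of x] x0 unfolding fib_def h_def s'_def w_def height_fractions_iff by auto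
    have inj: "inj_on rat_num (fib (d0, g0, m0, t0))"
      using fx(1) by (intro inj_onI rat_eqI) auto
    have "real (card (rat_num ` fib (d0, g0, m0, t0))) \<le> 2 * H / real_of_int m0 + 1"
    proof (rule card_congruent_le)
      show "m0 dvd a - b" if "a \<in> rat_num ` fib (d0, g0, m0, t0)" "b \<in> rat_num ` fib (d0, g0, m0, t0)" for a b
      proof -
        obtain x y where x: "x \<in> fib (d0, g0, m0, t0)" "a = rat_num x"
          and y: "y \<in> fib (d0, g0, m0, t0)" "b = rat_num y" using \<open>a \<in> _\<close> \<open>b \<in> _\<close> by blast
        \<comment> \<open>Both numerators solve the same congruence modulo \<open>m0\<close>, in
          which the coefficient \<open>s' x0 * w x0\<close> is invertible.\<close>
        have "m0 dvd u * t0 - a * s' x0 * w x0" using fx[OF x(1)] x(2) by (metis m_def gcd_dvd1)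
        moreover have "m0 dvd u * t0 - b * s' x0 * w x0" using fx[OF y(1)] y(2) by (metis m_def gcd_dvd1)
        ultimately have "m0 dvd (u * t0 - b * s' x0 * w x0) - (u * t0 - a * s' x0 * w x0)" by (rule dvd_diff[rotated])
        then have "m0 dvd (a - b) * (s' x0 * w x0)" by (simp add: algebra_simps)
        then show ?thesis using defs(3)[of x0] x0(4) by (metis coprime_dvd_mult_left_iff)
      qed
    qed (use fx H m0 in auto)
    also have "\<dots> \<le> 3 * H / real_of_int m0" using m0 m0H by (simp add: field_simps)
    finally have cardle: "real (card (fib (d0, g0, m0, t0))) \<le> 3 * H / real_of_int m0"
      by (simp add: card_image[OF inj])
    have "(\<Sum>x\<in>fib (d0, g0, m0, t0). 1 / real_of_int (rat_den (e - of_int s * x)))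
        = (\<Sum>x\<in>fib (d0, g0, m0, t0). real_of_int m0 / (real_of_int t0 * real_of_int v))"
    proof (rule sum.cong)
      fix x assume x: "x \<in> fib (d0, g0, m0, t0)"
      have "rat_den (e - of_int s * x) * m0 = t0 * v" using defs(1)[of x] fx[OF x] by simp
      then have "real_of_int (rat_den (e - of_int s * x)) * real_of_int m0 = real_of_int t0 * real_of_int v"
        by (metis of_int_mult)
      then show "1 / real_of_int (rat_den (e - of_int s * x)) = real_of_int m0 / (real_of_int t0 * real_of_int v)"
        using rat_den_pos[of "e - of_int s * x"] t0 v by (simp add: field_simps)
    qed simp
    also have "\<dots> = real (card (fib (d0, g0, m0, t0))) * (real_of_int m0 / (real_of_int t0 * real_of_int v))"
      by simp
    also have "\<dots> \<le> (3 * H / real_of_int m0) * (real_of_int m0 / (real_of_int t0 * real_of_int v))"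
      using m0 t0 v by (intro mult_right_mono cardle) simp
    also have "\<dots> = 3 * H / real_of_int v * (1 / real_of_int t0)" using m0 by simp
    finally show ?thesis .
  qed
  have "(\<Sum>x\<in>?F. 1 / real_of_int (rat_den (e - of_int s * x)))
      = (\<Sum>y\<in>Y. \<Sum>x\<in>fib y. 1 / real_of_int (rat_den (e - of_int s * x)))"
    unfolding fib_def by (rule sum.group[symmetric]) (auto simp: finite_height_fractions finY hY[unfolded image_subset_iff])
  also have "\<dots> \<le> (\<Sum>(d0, g0, m0, t0)\<in>Y. 3 * H / real_of_int v * (1 / real_of_int t0))"
    using fib by (intro sum_mono) (auto split: prod.splits)
  also have "\<dots> = real (card {k. k dvd s}) * (real (card {k. k dvd v}))\<^sup>2 * (3 * H / real_of_int v * (\<Sum>k\<in>{1..\<lfloor>H\<rfloor>}. 1 / real_of_int k))"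
    unfolding Y_def sum_distrib_left
    by (simp add: sum.cartesian_product[symmetric] sum_distrib_left power2_eq_square mult.assoc)
  also have "\<dots> \<le> real (card {k. k dvd s}) * (real (card {k. k dvd v}))\<^sup>2 * (3 * H / real_of_int v * (1 + ln H))"
    using H v by (intro mult_left_mono sum_inverse_le_ln) auto
  finally show ?thesis by (simp add: v_def)
qed

section \<open>Linear equations in fractions of bounded height\<close>

lemma rat_den_add_mult_le:
  "rat_den (e + of_int s * x) \<le> rat_den e * rat_den x"
proof -
  let ?N = "rat_num e * rat_den x + s * rat_num x * rat_den e"
  have pos: "rat_den e > 0" "rat_den x > 0" by (rule rat_den_pos)+
  then have pos': "rat_den e * rat_den x > 0" by simp
  have "e + of_int s * x = of_int (rat_num e) / of_int (rat_den e) + of_int s * (of_int (rat_num x) / of_int (rat_den x))"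
    by (simp only: num_div_den)
  also have "\<dots> = of_int ?N / of_int (rat_den e * rat_den x)"
    using pos by (simp add: field_simps)
  finally have "rat_den (e + of_int s * x) = (rat_den e * rat_den x) div gcd ?N (rat_den e * rat_den x)"
    by (simp only: num_den_divide(2)[OF pos'])
  also have "\<dots> \<le> rat_den e * rat_den x"
    using pos' by (intro zdvd_imp_le div_dvd_iff_mult[THEN iffD2]) auto
  finally show ?thesis .
qed

lemma rat_den_0: "rat_den 0 = 1"
  by (simp add: rat_den_def)

text \<open>Limits the attainable right-hand sides, so that divisor counts are needed only for
  denominators of polynomial size.\<close>

lemma rat_den_sum_le:
  assumes "finite I" "H \<ge> 1" "\<And>j. j \<in> I \<Longrightarrow> x j \<in> height_fractions H"
  shows "real_of_int (rat_den (\<Sum>j\<in>I. of_int (c j) * x j)) \<le> H ^ card I"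
  using assms(1,3)
proof (induction I rule: finite_induct)
  case empty
  then show ?case by (simp add: rat_den_0)
next
  case (insert i I)
  let ?e = "\<Sum>j\<in>I. of_int (c j) * x j"
  have "real_of_int (rat_den (?e + of_int (c i) * x i)) \<le> real_of_int (rat_den ?e * rat_den (x i))"
    using rat_den_add_mult_le by (simp only: of_int_le_iff)
  also have "\<dots> = real_of_int (rat_den ?e) * real_of_int (rat_den (x i))" by simp
  also have "\<dots> \<le> H ^ card I * H"
    using insert assms(2) rat_den_pos[of "x i"]
    by (intro mult_mono) (auto simp: height_fractions_iff)
  finally show ?case using insert by (simp add: add.commute mult.commute)
qed

text \<open>
  The saving of the factor \<open>rat_den e\<close> is not needed in the end: it is the invariant that lets the
  variables be summed out one at a time by the preceding average over \<open>1 / rat_den (e - c i * y)\<close>.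
\<close>
lemma card_linear_solutions_le:
  fixes c :: "'a \<Rightarrow> int" and H B D K P :: real
  assumes "finite I" and H: "H \<ge> 1"
    and D: "\<And>m::int. m \<noteq> 0 \<Longrightarrow> \<bar>real_of_int m\<bar> \<le> B \<Longrightarrow> real (card {k. k dvd m}) \<le> D"
    and B: "H ^ card I \<le> B" "\<And>j. j \<in> I \<Longrightarrow> \<bar>real_of_int (c j)\<bar> \<le> B"
    and P: "real (card (height_fractions H)) \<le> P"
    and K: "D ^ 3 * (3 * H * (1 + ln H)) \<le> K"
  shows "real (card {x \<in> I \<rightarrow>\<^sub>E height_fractions H. (\<Sum>j\<in>I. of_int (c j) * x j) = e})
    \<le> (\<Prod>j\<in>I. if c j = 0 then P else K) / real_of_int (rat_den e)"
  using assms(1) B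
proof (induction I arbitrary: e rule: finite_induct)
  case empty
  \<comment> \<open>With no variables only \<open>e = 0\<close> is attained, and its denominator is
    1, so the quotient by \<open>rat_den e\<close> loses nothing at the start.\<close>
  have "card {x :: 'a \<Rightarrow> rat. x = (\<lambda>_. undefined) \<and> 0 = e} \<le> (if e = 0 then 1 else 0)"
    by (cases "e = 0") (auto simp: Collect_conv_if)
  then show ?case by (auto simp: rat_den_0 rat_den_pos less_imp_le split: if_splits)
next
  case (insert i I)
  let ?F = "height_fractions H"
  define S where "S J e = {x \<in> J \<rightarrow>\<^sub>E ?F. (\<Sum>j\<in>J. of_int (c j) * x j) = e}" for J e
  define Q where "Q = (\<Prod>j\<in>I. if c j = 0 then P else K)"
  have "B \<ge> 1" using insert.prems(1) one_le_power[OF H, of "card (insert i I)"] by linarith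
  then have "real (card {k. k dvd (1::int)}) \<le> D" using D[of 1] by simp
  then have D0: "D \<ge> 0" by linarith
  have K0: "K \<ge> 0"
  proof -
    have "0 \<le> D ^ 3 * (3 * H * (1 + ln H))" using D0 H by simp
    then show ?thesis using K by linarith
  qed
  have P0: "P \<ge> 0" using P by linarith
  have Q0: "Q \<ge> 0" unfolding Q_def using P0 K0 by (intro prod_nonneg) auto
  have finS: "finite (S J e)" if "finite J" for J e
    unfolding S_def using that by (intro finite_subset[OF _ finite_PiE[of J "\<lambda>_. ?F"]]) (auto simp: finite_height_fractions)
  have IH: "real (card (S I e)) \<le> Q / real_of_int (rat_den e)" for e
    unfolding S_def Q_def
  proof (rule insert.IH)
    have "H ^ card I \<le> H ^ card (insert i I)"
      using H insert.hyps by (intro power_increasing card_mono) auto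
    then show "H ^ card I \<le> B" using insert.prems(1) by linarith
  qed (use insert.prems in auto)
  have "S (insert i I) e \<subseteq> (\<lambda>(y, g). g(i := y)) ` (SIGMA y:?F. S I (e - of_int (c i) * y))"
  proof
    fix x assume x: "x \<in> S (insert i I) e"
    then obtain y g where yg: "x = g(i := y)" "y \<in> ?F" "g \<in> I \<rightarrow>\<^sub>E ?F"
      unfolding S_def PiE_insert_eq by auto
    have "(\<Sum>j\<in>I. of_int (c j) * x j) = (\<Sum>j\<in>I. of_int (c j) * g j)"
      using insert.hyps yg(1) by (intro sum.cong) auto
    then have "of_int (c i) * y + (\<Sum>j\<in>I. of_int (c j) * g j) = e"
      using x insert.hyps yg(1) by (auto simp: S_def)
    then have "g \<in> S I (e - of_int (c i) * y)" using yg(3) by (auto simp: S_def)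
    with yg show "x \<in> (\<lambda>(y, g). g(i := y)) ` (SIGMA y:?F. S I (e - of_int (c i) * y))" by force
  qed
  then have "card (S (insert i I) e) \<le> card (SIGMA y:?F. S I (e - of_int (c i) * y))"
    using insert.hyps finS by (intro surj_card_le finite_SigmaI finite_height_fractions) auto
  also have "\<dots> = (\<Sum>y\<in>?F. card (S I (e - of_int (c i) * y)))"
    using insert.hyps finS by (intro card_SigmaI finite_height_fractions) auto
  finally have step: "real (card (S (insert i I) e)) \<le> (\<Sum>y\<in>?F. real (card (S I (e - of_int (c i) * y))))"
    by (simp only: of_nat_le_iff flip: of_nat_sum)
  let ?v = "real_of_int (rat_den e)"
  have v: "?v > 0" by (simp add: rat_den_pos)
  have "real (card (S (insert i I) e)) \<le> (if c i = 0 then P else K) * Q / ?v"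
  proof (cases "c i = 0")
    case True
    have "(\<Sum>y\<in>?F. real (card (S I (e - of_int (c i) * y)))) = real (card ?F) * real (card (S I e))"
      using True by simp
    also have "\<dots> \<le> P * (Q / ?v)" using P P0 IH by (intro mult_mono) auto
    finally show ?thesis using step True by simp
  next
    case False
    show ?thesis
    \<comment> \<open>\<open>D\<close> controls divisor counts only up to \<open>B\<close>. By
      \<open>rat_den_sum_le\<close> a larger denominator is never attained, so there are no
      solutions in that case.\<close>
    proof (cases "?v \<le> B")
      case True
      have "(\<Sum>y\<in>?F. real (card (S I (e - of_int (c i) * y))))
          \<le> (\<Sum>y\<in>?F. Q * (1 / real_of_int (rat_den (e - of_int (c i) * y))))"
        using IH by (intro sum_mono) simp
      also have "\<dots> = Q * (\<Sum>y\<in>?F. 1 / real_of_int (rat_den (e - of_int (c i) * y)))"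
        by (simp add: sum_distrib_left)
      also have "\<dots> \<le> Q * (real (card {k. k dvd c i}) * (real (card {k. k dvd rat_den e}))\<^sup>2 * (3 * H * (1 + ln H)) / ?v)"
        by (intro mult_left_mono sum_inverse_den_le H False Q0)
      also have "\<dots> \<le> Q * (K / ?v)"
      proof (intro mult_left_mono divide_right_mono Q0)
        \<comment> \<open>One divisor count comes from the coefficient and two from
          \<open>rat_den e\<close>, hence the cube of \<open>D\<close> in the hypothesis on
          \<open>K\<close>.\<close>
        have "real (card {k. k dvd c i}) * (real (card {k. k dvd rat_den e}))\<^sup>2 \<le> D * D\<^sup>2"
          using D[of "c i"] D[of "rat_den e"] False insert.prems(2)[of i] True rat_den_pos[of e] D0
          by (intro mult_mono power_mono) auto
        then have "real (card {k. k dvd c i}) * (real (card {k. k dvd rat_den e}))\<^sup>2 * (3 * H * (1 + ln H))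
            \<le> D * D\<^sup>2 * (3 * H * (1 + ln H))"
          using H by (intro mult_right_mono) auto
        also have "D * D\<^sup>2 = D ^ 3" by (simp add: power2_eq_square power3_eq_cube)
        finally show "real (card {k. k dvd c i}) * (real (card {k. k dvd rat_den e}))\<^sup>2 * (3 * H * (1 + ln H)) \<le> K"
          using K by linarith
      qed (use v in simp)
      finally show ?thesis using step False by (simp add: mult.commute)
    next
      case no_sol: False
      have "S (insert i I) e = {}"
      proof (rule ccontr)
        assume "S (insert i I) e \<noteq> {}"
        then obtain x where "x \<in> S (insert i I) e" by auto
        then have "?v \<le> H ^ card (insert i I)"
          using rat_den_sum_le[of "insert i I" H x c] insert.hyps H by (auto simp: S_def PiE_iff simp del: sum.insert card_insert_disjoint)
        then show False using no_sol insert.prems(1) by linarith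
      qed
      then show ?thesis using K0 P0 Q0 v by simp
    qed
  qed
  then show ?case
    unfolding S_def Q_def using insert.hyps by simp
qed

section \<open>Counting one row when the other rows are fixed\<close>

lemma card_height_fractions_le:
  assumes "H \<ge> 1"
  shows "real (card (height_fractions H)) \<le> 3 * H\<^sup>2"
proof -
  let ?f = "\<lambda>x. (rat_num x, rat_den x)"
  let ?h = "\<lfloor>H\<rfloor>"
  have h: "?h \<ge> 1" "real_of_int ?h \<le> H" using assms by (simp_all add: le_floor_iff)
  have "card (height_fractions H) \<le> card ({-?h..?h} \<times> {1..?h})"
  proof (rule card_inj_on_le)
    show "inj_on ?f (height_fractions H)" by (rule inj_onI) (auto intro: rat_eqI)
    show "?f ` height_fractions H \<subseteq> {-?h..?h} \<times> {1..?h}"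
    proof
      fix y assume "y \<in> ?f ` height_fractions H"
      then obtain x where x: "y = (rat_num x, rat_den x)" "\<bar>real_of_int (rat_num x)\<bar> \<le> H" "real_of_int (rat_den x) \<le> H"
        by (auto simp: height_fractions_iff)
      have "rat_num x \<le> ?h" "- rat_num x \<le> ?h" "rat_den x \<le> ?h"
        using x unfolding le_floor_iff by linarith+
      then show "y \<in> {-?h..?h} \<times> {1..?h}" using x(1) rat_den_pos[of x] by auto
    qed
  qed auto
  also have "\<dots> = nat (2 * ?h + 1) * nat ?h" by (simp add: card_cartesian_product)
  finally have "real (card (height_fractions H)) \<le> real (nat (2 * ?h + 1)) * real (nat ?h)"
    by (simp only: of_nat_le_iff flip: of_nat_mult)
  also have "\<dots> = (2 * real_of_int ?h + 1) * real_of_int ?h" using h by simp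
  also have "\<dots> \<le> (3 * H) * H" using h assms by (intro mult_mono) linarith+
  finally show ?thesis by (simp add: power2_eq_square)
qed

text \<open>The Leibniz formula gives a crude polynomial bound, which is enough because coefficient
  sizes enter later only through divisor counts.\<close>

lemma abs_det_le:
  fixes A :: "int mat" and M :: real
  assumes A: "A \<in> carrier_mat n n"
    and M: "\<And>i j. i < n \<Longrightarrow> j < n \<Longrightarrow> \<bar>real_of_int (A $$ (i, j))\<bar> \<le> M"
  shows "\<bar>real_of_int (det A)\<bar> \<le> fact n * M ^ n"
proof -
  let ?S = "{p. p permutes {0..<n}}"
  have "real_of_int (det A) = (\<Sum>p\<in>?S. real_of_int (signof p * (\<Prod>i = 0..<n. A $$ (i, p i))))"
    by (simp only: det_def'[OF A] of_int_sum)
  also have "\<bar>\<dots>\<bar> \<le> (\<Sum>p\<in>?S. \<bar>real_of_int (signof p * (\<Prod>i = 0..<n. A $$ (i, p i)))\<bar>)"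
    by (rule sum_abs)
  also have "\<dots> \<le> (\<Sum>p\<in>?S. M ^ n)"
  proof (rule sum_mono)
    fix p assume p: "p \<in> ?S"
    have "\<bar>real_of_int (signof p * (\<Prod>i = 0..<n. A $$ (i, p i)))\<bar> = (\<Prod>i = 0..<n. \<bar>real_of_int (A $$ (i, p i))\<bar>)"
      by (simp add: abs_mult sign_def abs_prod)
    also have "\<dots> \<le> (\<Prod>i = 0..<n. M)"
      using M permutes_in_image[of p "{0..<n}"] p by (intro prod_mono) auto
    finally show "\<bar>real_of_int (signof p * (\<Prod>i = 0..<n. A $$ (i, p i)))\<bar> \<le> M ^ n" by simp
  qed
  also have "\<dots> = fact n * M ^ n"
    by (simp add: card_permutations[of "{0..<n}" n])
  finally show ?thesis .
qed

lemma abs_height_fraction_le: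
  assumes "x \<in> height_fractions H"
  shows "\<bar>real_of_rat x\<bar> \<le> H"
proof -
  have "real_of_rat x = real_of_int (rat_num x) / real_of_int (rat_den x)"
    by (subst num_div_den[of x, symmetric]) (simp add: of_rat_divide)
  moreover have "\<bar>real_of_int (rat_num x) / real_of_int (rat_den x)\<bar> \<le> \<bar>real_of_int (rat_num x)\<bar> / 1"
    unfolding abs_divide using rat_den_pos[of x] by (intro divide_left_mono) auto
  ultimately show ?thesis using assms by (simp add: height_fractions_iff)
qed

text \<open>Multiplying \<open>R\<close> by a common denominator makes it integral, and cofactors
  are homogeneous of degree \<open>n - 1\<close>. So one nonzero factor clears all cofactors along
  the row at once, without changing which of them vanish.\<close>

lemma cofactor_integer_multiple:
  assumes R: "R \<in> height_mats n H" and H: "H \<ge> 1" and i: "i < n"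
  obtains q :: rat and s :: "nat \<Rightarrow> int" where "q \<noteq> 0"
    "\<And>j. j < n \<Longrightarrow> of_int (s j) = q * cofactor R i j"
    "\<And>j. j < n \<Longrightarrow> \<bar>real_of_int (s j)\<bar> \<le> fact (n - 1) * (H ^ (n\<^sup>2 + 1)) ^ (n - 1)"
proof -
  let ?I = "{..<n} \<times> {..<n}"
  \<comment> \<open>The full product rather than the least common multiple: divisibility by every
    denominator and the bound \<open>H ^ n\<^sup>2\<close> are both immediate.\<close>
  define q where "q = (\<Prod>rc\<in>?I. rat_den (R $$ rc))"
  have Rc: "R \<in> carrier_mat n n" using R by (simp add: height_mats_def)
  have RF: "R $$ (r, c) \<in> height_fractions H" if "r < n" "c < n" for r c
    using R that by (simp add: height_mats_def)
  have q0: "q > 0" unfolding q_def by (intro prod_pos rat_den_pos)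
  have qH: "real_of_int q \<le> H ^ n\<^sup>2"
  proof -
    have "real_of_int q = (\<Prod>rc\<in>?I. real_of_int (rat_den (R $$ rc)))" by (simp add: q_def)
    also have "\<dots> \<le> (\<Prod>rc\<in>?I. H)"
      using RF rat_den_pos by (intro prod_mono) (auto simp: height_fractions_iff less_imp_le)
    finally show ?thesis by (simp add: card_cartesian_product power2_eq_square)
  qed
  define Z where "Z = mat n n (\<lambda>rc. rat_num (R $$ rc) * (q div rat_den (R $$ rc)))"
  have Z: "Z \<in> carrier_mat n n" by (simp add: Z_def)
  have Zeq: "of_int (Z $$ (r, c)) = of_int q * R $$ (r, c)" if "r < n" "c < n" for r c
  proof -
    have "rat_den (R $$ (r, c)) dvd q" unfolding q_def by (rule dvd_prodI) (use that in auto)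
    then obtain k where k: "q = rat_den (R $$ (r, c)) * k" by (rule dvdE)
    have "of_int q * R $$ (r, c) = of_int q * (of_int (rat_num (R $$ (r, c))) / of_int (rat_den (R $$ (r, c))))"
      by (simp only: num_div_den)
    also have "\<dots> = of_int (rat_num (R $$ (r, c)) * k)"
      using rat_den_pos[of "R $$ (r, c)"] by (simp add: k)
    also have "rat_num (R $$ (r, c)) * k = Z $$ (r, c)"
      using that k rat_den_pos[of "R $$ (r, c)"] by (simp add: Z_def)
    finally show ?thesis by simp
  qed
  have Zle: "\<bar>real_of_int (Z $$ (r, c))\<bar> \<le> H ^ (n\<^sup>2 + 1)" if "r < n" "c < n" for r c
  proof -
    have "real_of_int (Z $$ (r, c)) = real_of_rat (of_int (Z $$ (r, c)))" by simp
    also have "\<dots> = real_of_int q * real_of_rat (R $$ (r, c))"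
      unfolding Zeq[OF that] by (simp add: of_rat_mult)
    finally have "\<bar>real_of_int (Z $$ (r, c))\<bar> = real_of_int q * \<bar>real_of_rat (R $$ (r, c))\<bar>"
      using q0 by (simp add: abs_mult)
    also have "\<dots> \<le> H ^ n\<^sup>2 * H"
      using qH q0 H RF[OF that] by (intro mult_mono abs_height_fraction_le) auto
    finally show ?thesis by (simp add: mult.commute)
  qed
  have del: "mat_delete R i j \<in> carrier_mat (n - 1) (n - 1)" "mat_delete Z i j \<in> carrier_mat (n - 1) (n - 1)" for j
    using mat_delete_carrier Rc Z by blast+
  have cof: "of_int (cofactor Z i j) = of_int q ^ (n - 1) * cofactor R i j" if j: "j < n" for j
  proof -
    have "map_mat of_int (mat_delete Z i j) = of_int q \<cdot>\<^sub>m mat_delete R i j"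
      using Zeq Z Rc i j by (intro eq_matI) (auto simp: mat_delete_def)
    then have "(of_int (det (mat_delete Z i j)) :: rat) = det (of_int q \<cdot>\<^sub>m mat_delete R i j)"
      by (metis of_int_hom.hom_det)
    also have "\<dots> = of_int q ^ (n - 1) * det (mat_delete R i j)"
      using carrier_matD(2)[OF Rc] by simp
    finally show ?thesis by (simp add: cofactor_def)
  qed
  have bound: "\<bar>real_of_int (cofactor Z i j)\<bar> \<le> fact (n - 1) * (H ^ (n\<^sup>2 + 1)) ^ (n - 1)" if j: "j < n" for j
  proof -
    have "\<bar>real_of_int (cofactor Z i j)\<bar> = \<bar>real_of_int (det (mat_delete Z i j))\<bar>"
      by (simp add: cofactor_def abs_mult power_abs)
    also have "\<dots> \<le> fact (n - 1) * (H ^ (n\<^sup>2 + 1)) ^ (n - 1)"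
      using Zle Z i j by (intro abs_det_le[OF del(2)]) (auto simp: mat_delete_def)
    finally show ?thesis .
  qed
  show ?thesis
    by (rule that[of "of_int q ^ (n - 1)" "cofactor Z i"]) (use q0 cof bound in auto)
qed

text \<open>With the other rows fixed, prescribing the determinant is one linear equation for row
  \<open>i\<close>, with cofactors as coefficients. Each nonzero cofactor saves a factor of about
  \<open>H\<close>; where the cofactor vanishes, the entry is free, and \<open>L \<ge> 3\<close>
  makes its factor dominate the number of all fractions.\<close>

lemma card_rows_le:
  fixes \<epsilon> :: real
  assumes \<epsilon>: "\<epsilon> > 0"
  shows "\<exists>L\<ge>3. \<forall>H\<ge>1. \<forall>R\<in>height_mats n H. \<forall>i<n. \<forall>\<delta>.
    real (card {x \<in> {..<n} \<rightarrow>\<^sub>E height_fractions H. (\<Sum>j<n. x j * cofactor R i j) = \<delta>})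
      \<le> (\<Prod>j<n. if cofactor R i j = 0 then L * H powr \<epsilon> * H\<^sup>2 else L * H powr \<epsilon> * H)"
proof -
  \<comment> \<open>\<open>C1 * H ^ E\<close> dominates both the integer coefficients and the
    \<open>H ^ n\<close> that bounds attainable denominators.\<close>
  define E where "E = (n\<^sup>2 + 1) * n"
  \<comment> \<open>Constants aside, three divisor counts of numbers up to \<open>C1 * H ^ E\<close>
    cost \<open>H powr (3 * E * \<eta>)\<close>, and the logarithm costs one more
    \<open>H powr \<eta>\<close>; together this is \<open>H powr \<epsilon>\<close>.\<close>
  define \<eta> where "\<eta> = \<epsilon> / (3 * real E + 1)"
  have \<eta>: "\<eta> > 0" "(3 * real E + 1) * \<eta> = \<epsilon>" using \<epsilon> by (simp_all add: \<eta>_def)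
  obtain C0 where C0: "C0 > 0"
    and div: "\<And>m::int. m \<noteq> 0 \<Longrightarrow> real (card {d. d dvd m}) \<le> C0 * \<bar>real_of_int m\<bar> powr \<eta>"
    using divisor_bound[OF \<eta>(1)] by blast
  define C1 :: real where "C1 = fact n + 1"
  have C1: "C1 \<ge> 1" by (simp add: C1_def)
  \<comment> \<open>Gathers the constants of \<open>D ^ 3\<close>, of \<open>3 * H\<close> and of
    \<open>1 + ln H \<le> (1 + 1 / \<eta>) * H powr \<eta>\<close>.\<close>
  define C2 where "C2 = (C0 * C1 powr \<eta>) ^ 3 * 3 * (1 + 1 / \<eta>)"
  define L where "L = max 3 C2"
  have "real (card {x \<in> {..<n} \<rightarrow>\<^sub>E height_fractions H. (\<Sum>j<n. x j * cofactor R i j) = \<delta>})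
      \<le> (\<Prod>j<n. if cofactor R i j = 0 then L * H powr \<epsilon> * H\<^sup>2 else L * H powr \<epsilon> * H)"
    if H: "H \<ge> 1" and R: "R \<in> height_mats n H" and i: "i < n" for H R i \<delta>
  proof -
    obtain q s where q: "q \<noteq> 0"
      and s: "\<And>j. j < n \<Longrightarrow> of_int (s j) = q * cofactor R i j"
      and sle: "\<And>j. j < n \<Longrightarrow> \<bar>real_of_int (s j)\<bar> \<le> fact (n - 1) * (H ^ (n\<^sup>2 + 1)) ^ (n - 1)"
      using cofactor_integer_multiple[OF R H i] by metis
    define B where "B = C1 * H ^ E"
    define D where "D = C0 * B powr \<eta>"
    have L3: "L \<ge> 3" and LC: "C2 \<le> L" by (simp_all add: L_def)
    have He: "H powr \<epsilon> \<ge> 1" using H \<epsilon> by (simp add: ge_one_powr_ge_zero)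
    have LH: "L * H powr \<epsilon> \<ge> 3" using mult_mono[of 3 L 1 "H powr \<epsilon>"] L3 He by simp
    have "real (card {x \<in> {..<n} \<rightarrow>\<^sub>E height_fractions H. (\<Sum>j<n. of_int (s j) * x j) = q * \<delta>})
      \<le> (\<Prod>j<n. if s j = 0 then L * H powr \<epsilon> * H\<^sup>2 else L * H powr \<epsilon> * H) / real_of_int (rat_den (q * \<delta>))"
    proof (rule card_linear_solutions_le[where B = B and D = D])
      show "real (card {k. k dvd m}) \<le> D" if "m \<noteq> 0" "\<bar>real_of_int m\<bar> \<le> B" for m
      proof -
        have "\<bar>real_of_int m\<bar> powr \<eta> \<le> B powr \<eta>" using that \<eta>(1) by (intro powr_mono2) auto
        then have "C0 * \<bar>real_of_int m\<bar> powr \<eta> \<le> D" unfolding D_def using C0 by (intro mult_left_mono) auto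
        then show ?thesis using div[OF that(1)] by linarith
      qed
      have "H ^ n \<le> H ^ E" using H by (intro power_increasing) (auto simp: E_def)
      also have "H ^ E \<le> C1 * H ^ E" using C1 H by simp
      finally show "H ^ card {..<n} \<le> B" by (simp add: B_def)
      show "\<bar>real_of_int (s j)\<bar> \<le> B" if "j \<in> {..<n}" for j
      proof -
        have "(H ^ (n\<^sup>2 + 1)) ^ (n - 1) = H ^ ((n\<^sup>2 + 1) * (n - 1))" by (simp only: power_mult)
        also have "\<dots> \<le> H ^ E" using H unfolding E_def by (intro power_increasing mult_le_mono) auto
        finally have *: "(H ^ (n\<^sup>2 + 1)) ^ (n - 1) \<le> H ^ E" .
        have "fact (n - 1) \<le> (fact n :: real)" by (intro fact_mono) simp
        then have "(fact (n - 1) :: real) \<le> C1" by (simp add: C1_def)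
        then have "fact (n - 1) * (H ^ (n\<^sup>2 + 1)) ^ (n - 1) \<le> B"
          unfolding B_def using * C1 H by (intro mult_mono) auto
        then show ?thesis using sle[of j] that by simp
      qed
      have "3 * H\<^sup>2 \<le> L * H powr \<epsilon> * H\<^sup>2" using LH H by (intro mult_right_mono) auto
      then show "real (card (height_fractions H)) \<le> L * H powr \<epsilon> * H\<^sup>2"
        using card_height_fractions_le[OF H] by linarith
      have D3: "D ^ 3 = (C0 * C1 powr \<eta>) ^ 3 * H powr (3 * real E * \<eta>)"
      proof -
        have "D = (C0 * C1 powr \<eta>) * H powr (real E * \<eta>)"
          unfolding D_def B_def using C1 H by (simp add: powr_mult powr_powr flip: powr_realpow)
        then have "D ^ 3 = (C0 * C1 powr \<eta>) ^ 3 * (H powr (real E * \<eta>)) ^ 3" by (simp only: power_mult_distrib)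
        also have "(H powr (real E * \<eta>)) ^ 3 = H powr (3 * real E * \<eta>)"
          by (simp add: power3_eq_cube algebra_simps flip: powr_add)
        finally show ?thesis .
      qed
      have "1 + ln H \<le> H powr \<eta> + H powr \<eta> / \<eta>"
        using ln_powr_bound[OF H \<eta>(1)] ge_one_powr_ge_zero[OF H, of \<eta>] \<eta>(1) by linarith
      also have "\<dots> = (1 + 1 / \<eta>) * H powr \<eta>" by (simp add: field_simps)
      finally have "D ^ 3 * (3 * H * (1 + ln H)) \<le> D ^ 3 * (3 * H * ((1 + 1 / \<eta>) * H powr \<eta>))"
        using H C0 by (intro mult_left_mono) (auto simp: D_def)
      also have "\<dots> = C2 * (H powr (3 * real E * \<eta>) * H powr \<eta>) * H"
        unfolding D3 C2_def by (simp only: ac_simps)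
      also have "H powr (3 * real E * \<eta>) * H powr \<eta> = H powr \<epsilon>"
        unfolding powr_add[symmetric] using \<eta>(2) by (simp add: distrib_right)
      also have "C2 * H powr \<epsilon> * H \<le> L * H powr \<epsilon> * H"
        using LC H by (intro mult_right_mono) auto
      finally show "D ^ 3 * (3 * H * (1 + ln H)) \<le> L * H powr \<epsilon> * H" .
    qed (use H in auto)
    \<comment> \<open>The denominator of \<open>q * \<delta>\<close> is at least 1; dropping it
      makes the bound uniform in \<open>\<delta>\<close>.\<close>
    also have "\<dots> \<le> (\<Prod>j<n. if s j = 0 then L * H powr \<epsilon> * H\<^sup>2 else L * H powr \<epsilon> * H) / 1"
      using LH H L3 rat_den_pos[of "q * \<delta>"] by (intro divide_left_mono prod_nonneg) auto
    also have "\<dots> = (\<Prod>j<n. if cofactor R i j = 0 then L * H powr \<epsilon> * H\<^sup>2 else L * H powr \<epsilon> * H)"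
    proof -
      have "s j = 0 \<longleftrightarrow> cofactor R i j = 0" if "j < n" for j
        using s[OF that] q by (metis mult_eq_0_iff of_int_eq_0_iff)
      then have "(\<Prod>j<n. if s j = 0 then L * H powr \<epsilon> * H\<^sup>2 else L * H powr \<epsilon> * H)
        = (\<Prod>j<n. if cofactor R i j = 0 then L * H powr \<epsilon> * H\<^sup>2 else L * H powr \<epsilon> * H)"
        by (intro prod.cong) auto
      then show ?thesis by simp
    qed
    also have "{x \<in> {..<n} \<rightarrow>\<^sub>E height_fractions H. (\<Sum>j<n. of_int (s j) * x j) = q * \<delta>}
        = {x \<in> {..<n} \<rightarrow>\<^sub>E height_fractions H. (\<Sum>j<n. x j * cofactor R i j) = \<delta>}"
    proof -
      have "(\<Sum>j<n. of_int (s j) * x j) = q * (\<Sum>j<n. x j * cofactor R i j)" for x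
        unfolding sum_distrib_left using s by (intro sum.cong) (auto simp: mult_ac)
      then show ?thesis using q by auto
    qed
    finally show ?thesis .
  qed
  then show ?thesis by (intro exI[of _ L]) (auto simp: L_def)
qed

section \<open>Matrices with one row erased\<close>

text \<open>Erasing by zeros instead of deleting keeps a square matrix square, so the cofactors
  along row \<open>i\<close> stay available and unchanged.\<close>

definition zero_row :: "nat \<Rightarrow> 'a::zero mat \<Rightarrow> 'a mat" where
  "zero_row i A = mat (dim_row A) (dim_col A) (\<lambda>(r, c). if r = i then 0 else A $$ (r, c))"

lemma zero_row_carrier: "A \<in> carrier_mat m n \<Longrightarrow> zero_row i A \<in> carrier_mat m n"
  by (simp add: zero_row_def)

lemma zero_row_index:
  "A \<in> carrier_mat m n \<Longrightarrow> r < m \<Longrightarrow> c < n \<Longrightarrow> zero_row i A $$ (r, c) = (if r = i then 0 else A $$ (r, c))"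
  by (simp add: zero_row_def)

lemma cofactor_zero_row:
  assumes "A \<in> carrier_mat n n" "i < n" "j < n"
  shows "cofactor (zero_row i A) i j = cofactor A i j"
proof -
  have "mat_delete (zero_row i A) i j = mat_delete A i j"
    using assms by (intro eq_matI) (auto simp: mat_delete_def zero_row_def)
  then show ?thesis by (simp add: cofactor_def)
qed

lemma singular_kernel:
  fixes A :: "'a::field mat"
  assumes A: "A \<in> carrier_mat n n" and "det A = 0"
  obtains w :: "nat \<Rightarrow> 'a" where "\<exists>c<n. w c \<noteq> 0" "\<And>r. r < n \<Longrightarrow> (\<Sum>c<n. A $$ (r, c) * w c) = 0"
proof -
  obtain v where v: "v \<in> carrier_vec n" "v \<noteq> 0\<^sub>v n" "A *\<^sub>v v = 0\<^sub>v n"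
    using assms det_0_iff_vec_prod_zero_field[OF A] by blast
  have "\<exists>c<n. v $ c \<noteq> 0"
  proof (rule ccontr)
    assume "\<not> ?thesis"
    then have "v = 0\<^sub>v n" using v(1) by (intro eq_vecI) auto
    with v(2) show False by simp
  qed
  moreover have "(\<Sum>c<n. A $$ (r, c) * v $ c) = 0" if "r < n" for r
  proof -
    have "(A *\<^sub>v v) $ r = 0" using that by (simp add: v(3))
    then show ?thesis using A v(1) that by (simp add: scalar_prod_def lessThan_atLeast0)
  qed
  ultimately show ?thesis by (rule that[of "\<lambda>c. v $ c"])
qed

text \<open>Multiply the row relation with coefficients \<open>v\<close> by \<open>w\<close> and sum
  over the columns: every row other than \<open>i\<close> contributes 0, and \<open>v i\<close> can
  be divided out.\<close>

lemma row_orthogonal_kernel: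
  fixes a :: "nat \<Rightarrow> nat \<Rightarrow> 'a::field"
  assumes "i < n" "v i \<noteq> 0" "\<And>c. c < n \<Longrightarrow> (\<Sum>r<n. v r * a r c) = 0"
    and w: "\<And>r. r < n \<Longrightarrow> r \<noteq> i \<Longrightarrow> (\<Sum>c<n. a r c * w c) = 0"
  shows "(\<Sum>c<n. a i c * w c) = 0"
proof -
  have "0 = (\<Sum>c<n. (\<Sum>r<n. v r * a r c) * w c)"
    using assms(3) by simp
  also have "\<dots> = (\<Sum>c<n. \<Sum>r<n. v r * a r c * w c)" by (simp add: sum_distrib_right)
  also have "\<dots> = (\<Sum>r<n. \<Sum>c<n. v r * a r c * w c)" by (rule sum.swap)
  also have "\<dots> = (\<Sum>r<n. v r * (\<Sum>c<n. a r c * w c))" by (simp add: sum_distrib_left mult.assoc)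
  also have "\<dots> = v i * (\<Sum>c<n. a i c * w c)"
    using assms(1) w by (subst sum.remove[of _ i]) auto
  finally show ?thesis using assms(2) by simp
qed

lemma card_le_card_mult_fibers:
  fixes k :: real
  assumes "finite B" "f ` A \<subseteq> B" "\<And>y. y \<in> B \<Longrightarrow> real (card {x \<in> A. f x = y}) \<le> k" "finite A"
  shows "real (card A) \<le> real (card B) * k"
proof -
  have "A = (\<Union>y\<in>B. {x \<in> A. f x = y})" using assms(2) by auto
  then have "card A \<le> (\<Sum>y\<in>B. card {x \<in> A. f x = y})"
    using card_UN_le[OF assms(1), of "\<lambda>y. {x \<in> A. f x = y}"] by simp
  then have "real (card A) \<le> (\<Sum>y\<in>B. real (card {x \<in> A. f x = y}))"
    by (simp only: of_nat_le_iff flip: of_nat_sum)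
  also have "\<dots> \<le> (\<Sum>y\<in>B. k)" using assms(3) by (intro sum_mono)
  finally show ?thesis by simp
qed

text \<open>Since \<open>w j\<close> is nonzero, the other coordinates determine coordinate
  \<open>j\<close>.\<close>

lemma card_hyperplane_le:
  fixes w :: "nat \<Rightarrow> 'a::field"
  assumes "finite F" "j < n" "w j \<noteq> 0"
  shows "card {x \<in> {..<n} \<rightarrow>\<^sub>E F. (\<Sum>c<n. x c * w c) = 0} \<le> card F ^ (n - 1)"
proof -
  let ?J = "{..<n} - {j}"
  have "card {x \<in> {..<n} \<rightarrow>\<^sub>E F. (\<Sum>c<n. x c * w c) = 0} \<le> card (?J \<rightarrow>\<^sub>E F)"
  proof (rule card_inj_on_le)
    show "inj_on (\<lambda>x. restrict x ?J) {x \<in> {..<n} \<rightarrow>\<^sub>E F. (\<Sum>c<n. x c * w c) = 0}"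
    proof (rule inj_onI)
      fix x y assume x: "x \<in> {x \<in> {..<n} \<rightarrow>\<^sub>E F. (\<Sum>c<n. x c * w c) = 0}"
        and y: "y \<in> {x \<in> {..<n} \<rightarrow>\<^sub>E F. (\<Sum>c<n. x c * w c) = 0}" and eq: "restrict x ?J = restrict y ?J"
      have xy: "x c = y c" if "c \<in> ?J" for c using fun_cong[OF eq, of c] that by simp
      have "(\<Sum>c<n. x c * w c) = x j * w j + (\<Sum>c\<in>?J. x c * w c)"
        "(\<Sum>c<n. y c * w c) = y j * w j + (\<Sum>c\<in>?J. y c * w c)"
        using assms(2) by (auto intro!: sum.remove)
      then have "x j * w j + (\<Sum>c\<in>?J. x c * w c) = y j * w j + (\<Sum>c\<in>?J. y c * w c)"
        using x y by simp
      moreover have "(\<Sum>c\<in>?J. x c * w c) = (\<Sum>c\<in>?J. y c * w c)" using xy by (intro sum.cong) auto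
      ultimately have "x j * w j = y j * w j" by simp
      then have "x j = y j" using assms(3) by simp
      with xy have "x c = y c" if "c \<in> {..<n}" for c using that by (cases "c = j") auto
      then show "x = y" using x y by (intro PiE_ext[of x "{..<n}" "\<lambda>_. F" y]) auto
    qed
    show "(\<lambda>x. restrict x ?J) ` {x \<in> {..<n} \<rightarrow>\<^sub>E F. (\<Sum>c<n. x c * w c) = 0} \<subseteq> ?J \<rightarrow>\<^sub>E F"
      by (auto simp: PiE_iff split: if_splits)
    show "finite (?J \<rightarrow>\<^sub>E F)" using assms(1) by (intro finite_PiE) auto
  qed
  also have "\<dots> = card F ^ (n - 1)" using assms by (simp add: card_funcsetE)
  finally show ?thesis .
qed

lemma finite_height_mats: "finite (height_mats n H)"
proof -
  let ?D = "{..<n} \<times> {..<n}"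
  have "finite ((\<lambda>f. mat n n f) ` (?D \<rightarrow>\<^sub>E height_fractions H))"
    by (intro finite_imageI finite_PiE) (auto simp: finite_height_fractions)
  moreover have "height_mats n H \<subseteq> (\<lambda>f. mat n n f) ` (?D \<rightarrow>\<^sub>E height_fractions H)"
  proof
    fix A assume A: "A \<in> height_mats n H"
    then have "A = mat n n (restrict (\<lambda>rc. A $$ rc) ?D)"
      by (intro eq_matI) (auto simp: height_mats_def)
    moreover have "restrict (\<lambda>rc. A $$ rc) ?D \<in> ?D \<rightarrow>\<^sub>E height_fractions H"
      using A by (auto simp: height_mats_def)
    ultimately show "A \<in> (\<lambda>f. mat n n f) ` (?D \<rightarrow>\<^sub>E height_fractions H)" by (rule image_eqI)
  qed
  ultimately show ?thesis by (rule finite_subset[rotated])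
qed

lemma zero_in_height_fractions: "H \<ge> 1 \<Longrightarrow> 0 \<in> height_fractions H"
  by (simp add: height_fractions_iff rat_den_0 rat_num_def)

lemma zero_row_height_mats:
  assumes "H \<ge> 1" "A \<in> height_mats n H"
  shows "zero_row i A \<in> height_mats n H"
  using assms zero_in_height_fractions by (auto simp: height_mats_def zero_row_index zero_row_carrier)

text \<open>For \<open>i < n\<close> and \<open>H \<ge> 1\<close> this is the image of
  \<open>height_mats n H\<close> under \<open>zero_row i\<close>: one representative for each choice
  of the other rows.\<close>

definition zero_row_mats :: "nat \<Rightarrow> real \<Rightarrow> nat \<Rightarrow> rat mat set" where
  "zero_row_mats n H i = {R \<in> height_mats n H. \<forall>c<n. R $$ (i, c) = 0}"

lemma card_zero_row_mats_le:
  assumes "i < Suc n"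
  shows "card (zero_row_mats (Suc n) H i) \<le> card (height_fractions H) ^ (n * Suc n)"
proof -
  let ?F = "height_fractions H" and ?D = "({..<Suc n} - {i}) \<times> {..<Suc n}"
  have "card (zero_row_mats (Suc n) H i) \<le> card (?D \<rightarrow>\<^sub>E ?F)"
  proof (rule card_inj_on_le)
    show "inj_on (\<lambda>R. restrict (\<lambda>rc. R $$ rc) ?D) (zero_row_mats (Suc n) H i)"
    proof (rule inj_onI)
      fix R S assume R: "R \<in> zero_row_mats (Suc n) H i" and S: "S \<in> zero_row_mats (Suc n) H i"
        and eq: "restrict (\<lambda>rc. R $$ rc) ?D = restrict (\<lambda>rc. S $$ rc) ?D"
      have "R $$ (r, c) = S $$ (r, c)" if "r < Suc n" "c < Suc n" for r c
        using fun_cong[OF eq, of "(r, c)"] R S that by (cases "r = i") (auto simp: zero_row_mats_def)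
      then show "R = S" using R S by (intro eq_matI) (auto simp: zero_row_mats_def height_mats_def)
    qed
    show "(\<lambda>R. restrict (\<lambda>rc. R $$ rc) ?D) ` zero_row_mats (Suc n) H i \<subseteq> ?D \<rightarrow>\<^sub>E ?F"
      by (auto simp: zero_row_mats_def height_mats_def PiE_iff split: if_splits)
    show "finite (?D \<rightarrow>\<^sub>E ?F)" by (intro finite_PiE) (auto simp: finite_height_fractions)
  qed
  also have "\<dots> = card ?F ^ (n * Suc n)"
    using assms by (simp add: card_funcsetE card_cartesian_product)
  finally show ?thesis .
qed

text \<open>\<open>R\<close> is recovered from the singular minor obtained by deleting row
  \<open>i\<close> and column \<open>j\<close>, together with the \<open>n\<close> entries of column
  \<open>j\<close> outside row \<open>i\<close>. Here the count in dimension \<open>n\<close> enters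
  the induction.\<close>

lemma card_zero_row_mats_cofactor_le:
  assumes i: "i < Suc n" and j: "j < Suc n"
  shows "card {R \<in> zero_row_mats (Suc n) H i. cofactor R i j = 0}
    \<le> card (height_det_mats n H 0) * card (height_fractions H) ^ n"
proof -
  let ?F = "height_fractions H" and ?D = "{..<Suc n} - {i}"
  let ?S = "{R \<in> zero_row_mats (Suc n) H i. cofactor R i j = 0}"
  let ?f = "\<lambda>R. (mat_delete R i j, restrict (\<lambda>r. R $$ (r, j)) ?D)"
  have Sc: "R \<in> carrier_mat (Suc n) (Suc n)" if "R \<in> ?S" for R
    using that by (simp add: zero_row_mats_def height_mats_def)
  have "card ?S \<le> card (height_det_mats n H 0 \<times> (?D \<rightarrow>\<^sub>E ?F))"
  proof (rule card_inj_on_le)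
    show "inj_on ?f ?S"
    proof (rule inj_onI)
      fix A B assume A: "A \<in> ?S" and B: "B \<in> ?S" and eq: "?f A = ?f B"
      have del: "mat_delete A i j = mat_delete B i j"
        and col: "restrict (\<lambda>r. A $$ (r, j)) ?D = restrict (\<lambda>r. B $$ (r, j)) ?D" using eq by auto
      have "A $$ (r, c) = B $$ (r, c)" if r: "r < Suc n" and c: "c < Suc n" for r c
      proof -
        consider "r = i" | "r \<noteq> i" "c = j" | "r \<noteq> i" "c \<noteq> j" by blast
        then show ?thesis
        proof cases
          case 1
          then show ?thesis using A B c by (simp add: zero_row_mats_def)
        next
          case 2
          then show ?thesis using fun_cong[OF col, of r] r by simp
        next
          case 3
          \<comment> \<open>\<open>r'\<close> and \<open>c'\<close> invert
            \<open>insert_index\<close>: indices beyond the deleted row or column move down by one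
            in the minor.\<close>
          define r' where "r' = (if r < i then r else r - 1)"
          define c' where "c' = (if c < j then c else c - 1)"
          have lt: "r' < n" "c' < n" using 3 r c i j by (auto simp: r'_def c'_def)
          have ins: "insert_index i r' = r" "insert_index j c' = c"
            using 3 by (auto simp: r'_def c'_def insert_index_def)
          show ?thesis
            using mat_delete_index[OF Sc[OF A] i j lt] mat_delete_index[OF Sc[OF B] i j lt] del
            unfolding ins by simp
        qed
      qed
      then show "A = B" using Sc[OF A] Sc[OF B] by (intro eq_matI) auto
    qed
    show "?f ` ?S \<subseteq> height_det_mats n H 0 \<times> (?D \<rightarrow>\<^sub>E ?F)"
    proof
      fix y assume "y \<in> ?f ` ?S"
      then obtain R where R: "R \<in> ?S" "y = ?f R" by auto
      have RF: "R $$ (r, c) \<in> ?F" if "r < Suc n" "c < Suc n" for r c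
        using R(1) that by (simp add: zero_row_mats_def height_mats_def)
      have del: "mat_delete R i j \<in> carrier_mat n n" using mat_delete_carrier[OF Sc[OF R(1)]] by simp
      have "mat_delete R i j $$ (r, c) \<in> ?F" if "r < n" "c < n" for r c
        using RF Sc[OF R(1)] that by (simp add: mat_delete_def)
      moreover have "det (mat_delete R i j) = 0" using R(1) by (simp add: cofactor_def)
      ultimately have "mat_delete R i j \<in> height_det_mats n H 0"
        using del by (simp add: height_det_mats_def height_mats_def)
      then show "y \<in> height_det_mats n H 0 \<times> (?D \<rightarrow>\<^sub>E ?F)" using RF R(2) j by auto
    qed
    show "finite (height_det_mats n H 0 \<times> (?D \<rightarrow>\<^sub>E ?F))"
      by (intro finite_cartesian_product finite_height_det_mats finite_PiE) (auto simp: finite_height_fractions)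
  qed
  also have "\<dots> = card (height_det_mats n H 0) * card ?F ^ n"
    using i by (simp add: card_funcsetE card_cartesian_product)
  finally show ?thesis .
qed

section \<open>Induction on the dimension\<close>

text \<open>The inductive step, where \<open>L\<close> stands for a constant times a small power of
  \<open>H\<close>. A row \<open>i\<close> is singled out in \<open>Suc n\<close> ways. If all its
  cofactors are nonzero, each of its entries saves a factor \<open>H\<close>. Otherwise a column
  with vanishing cofactor is chosen in \<open>Suc n\<close> ways, \<open>b\<close> counts the
  singular minor, and the row itself saves one more factor \<open>H\<close>.\<close>

lemma card_height_det_mats_Suc_le:
  fixes H L b :: real
  assumes H: "H \<ge> 1" and L: "L \<ge> 3"
    and rows: "\<And>R i \<delta>. R \<in> height_mats (Suc n) H \<Longrightarrow> i < Suc n \<Longrightarrow>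
      real (card {x \<in> {..<Suc n} \<rightarrow>\<^sub>E height_fractions H. (\<Sum>j<Suc n. x j * cofactor R i j) = \<delta>})
        \<le> (\<Prod>j<Suc n. if cofactor R i j = 0 then L * H\<^sup>2 else L * H)"
    and b: "real (card (height_det_mats n H 0)) \<le> b"
  shows "real (card (height_det_mats (Suc n) H \<delta>))
    \<le> real (Suc n) * ((L * H\<^sup>2) ^ (n * Suc n) * (L * H) ^ Suc n
      + real (Suc n) * (b * (L * H\<^sup>2) ^ n) * (L * H * (L * H\<^sup>2) ^ n))"
proof -
  let ?F = "height_fractions H" and ?N = "Suc n"
  let ?P = "L * H\<^sup>2" and ?K = "L * H"
  have "3 * H\<^sup>2 \<le> ?P" using L H by (intro mult_right_mono) auto
  then have F: "real (card ?F) \<le> ?P" using card_height_fractions_le[OF H] by linarith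
  have K1: "?K \<ge> 1" using mult_mono[of 1 L 1 H] L H by simp
  have KP: "?K \<le> ?P" using L H by (intro mult_left_mono) (auto simp: power2_eq_square)
  have K0: "?K \<ge> 0" and P0: "?P \<ge> 0" using K1 KP by linarith+
  have Fpow: "real (card ?F ^ k) \<le> ?P ^ k" for k using F by (simp add: power_mono)
  \<comment> \<open>The second alternative says that row \<open>i\<close> lies in the span of the others. It is needed for the
    matrices of rank below \<open>n\<close>, all of whose cofactors vanish.\<close>
  define S where "S i = {A \<in> height_det_mats ?N H \<delta>. (\<exists>j<?N. cofactor A i j \<noteq> 0) \<or>
    (\<exists>v. v i \<noteq> 0 \<and> (\<forall>c<?N. (\<Sum>r<?N. v r * A $$ (r, c)) = 0))}" for i
  have Sc: "A \<in> carrier_mat ?N ?N" "A \<in> height_mats ?N H" "det A = \<delta>" if "A \<in> S i" for A i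
    using that by (auto simp: S_def height_det_mats_def height_mats_def)
  have finS: "finite (S i)" for i
    unfolding S_def by (rule finite_subset[OF _ finite_height_det_mats[of ?N H \<delta>]]) auto
  have cover: "height_det_mats ?N H \<delta> \<subseteq> (\<Union>i<?N. S i)"
  proof
    fix A assume A: "A \<in> height_det_mats ?N H \<delta>"
    then have Ac: "A \<in> carrier_mat ?N ?N" by (simp add: height_det_mats_def height_mats_def)
    show "A \<in> (\<Union>i<?N. S i)"
    proof (cases "det A = 0")
      case True
      \<comment> \<open>A kernel vector of the transpose is a linear relation among the rows, and
        any row with nonzero coefficient can serve as \<open>i\<close>.\<close>
      then have "det A\<^sup>T = 0" using det_transpose[OF Ac] by simp
      then obtain v where v: "\<exists>r<?N. v r \<noteq> 0" "\<And>c. c < ?N \<Longrightarrow> (\<Sum>r<?N. A\<^sup>T $$ (c, r) * v r) = 0"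
        using singular_kernel[of "A\<^sup>T" ?N] Ac by (metis transpose_carrier_mat)
      obtain i where i: "i < ?N" "v i \<noteq> 0" using v(1) by blast
      have "(\<Sum>r<?N. v r * A $$ (r, c)) = 0" if "c < ?N" for c
      proof -
        have "(\<Sum>r<?N. v r * A $$ (r, c)) = (\<Sum>r<?N. A\<^sup>T $$ (c, r) * v r)"
          using Ac that by (intro sum.cong) (auto simp: mult.commute)
        then show ?thesis using v(2)[OF that] by simp
      qed
      then have "A \<in> S i" using A i by (auto simp: S_def)
      then show ?thesis using i(1) by blast
    next
      case False
      have "\<exists>j<?N. cofactor A 0 j \<noteq> 0"
      proof (rule ccontr)
        assume "\<not> ?thesis"
        then have "det A = 0" using laplace_expansion_row[OF Ac, of 0] by simp
        with False show False by simp
      qed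
      then have "A \<in> S 0" using A by (simp add: S_def)
      then show ?thesis by blast
    qed
  qed
  \<comment> \<open>Matrices in such a fibre agree outside row \<open>i\<close>, so this row
    determines them and it suffices to locate it in \<open>X\<close>.\<close>
  have fiber: "card {A \<in> S i. zero_row i A = R} \<le> card X"
    if i: "i < ?N" and X: "finite X"
      "\<And>A. A \<in> S i \<Longrightarrow> zero_row i A = R \<Longrightarrow> restrict (\<lambda>j. A $$ (i, j)) {..<?N} \<in> X" for i R X
  proof (rule card_inj_on_le)
    show "inj_on (\<lambda>A. restrict (\<lambda>j. A $$ (i, j)) {..<?N}) {A \<in> S i. zero_row i A = R}"
    proof (rule inj_onI)
      fix A B assume A: "A \<in> {A \<in> S i. zero_row i A = R}" and B: "B \<in> {A \<in> S i. zero_row i A = R}"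
        and eq: "restrict (\<lambda>j. A $$ (i, j)) {..<?N} = restrict (\<lambda>j. B $$ (i, j)) {..<?N}"
      have AB: "A \<in> carrier_mat ?N ?N" "B \<in> carrier_mat ?N ?N" using A B Sc(1) by blast+
      have "A $$ (r, c) = B $$ (r, c)" if "r < ?N" "c < ?N" for r c
      proof (cases "r = i")
        case True
        then show ?thesis using fun_cong[OF eq, of c] that by simp
      next
        case False
        then show ?thesis using zero_row_index[OF AB(1) that, of i] zero_row_index[OF AB(2) that, of i] A B by simp
      qed
      then show "A = B" using AB by (intro eq_matI) auto
    qed
  qed (use X in auto)
  have row_in: "restrict (\<lambda>j. A $$ (i, j)) {..<?N} \<in> {..<?N} \<rightarrow>\<^sub>E ?F" if "A \<in> S i" "i < ?N" for A i
    using Sc(2)[OF that(1)] that(2) by (auto simp: height_mats_def)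
  have fin_fun: "finite {x \<in> {..<?N} \<rightarrow>\<^sub>E ?F. Q x}" for Q
    by (rule finite_subset[of _ "{..<?N} \<rightarrow>\<^sub>E ?F"]) (auto simp: finite_height_fractions intro!: finite_PiE)
  have fiber1: "real (card {A \<in> S i. zero_row i A = R})
      \<le> (\<Prod>j<?N. if cofactor R i j = 0 then ?P else ?K)"
    if i: "i < ?N" and R: "R \<in> height_mats ?N H" for i R
  proof -
    let ?X = "{x \<in> {..<?N} \<rightarrow>\<^sub>E ?F. (\<Sum>j<?N. x j * cofactor R i j) = \<delta>}"
    have "card {A \<in> S i. zero_row i A = R} \<le> card ?X"
    proof (rule fiber[OF i fin_fun])
      fix A assume A: "A \<in> S i" "zero_row i A = R"
      have "\<delta> = (\<Sum>j<?N. A $$ (i, j) * cofactor A i j)"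
        using laplace_expansion_row[OF Sc(1)[OF A(1)] i] Sc(3)[OF A(1)] by simp
      also have "\<dots> = (\<Sum>j<?N. restrict (\<lambda>j. A $$ (i, j)) {..<?N} j * cofactor R i j)"
        using cofactor_zero_row[OF Sc(1)[OF A(1)] i] A(2) by (intro sum.cong) auto
      finally show "restrict (\<lambda>j. A $$ (i, j)) {..<?N} \<in> ?X" using row_in[OF A(1) i] by simp
    qed
    then show ?thesis using rows[OF R i, of \<delta>] by linarith
  qed
  \<comment> \<open>A saving of one factor \<open>H\<close> for every \<open>R\<close>: from a
    nonzero cofactor if there is one, otherwise from a hyperplane.\<close>
  have fiber2: "real (card {A \<in> S i. zero_row i A = R}) \<le> ?K * ?P ^ n"
    if i: "i < ?N" and R: "R \<in> zero_row_mats ?N H i" for i R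
  proof (cases "\<exists>j<?N. cofactor R i j \<noteq> 0")
    case True
    then obtain j where j: "j < ?N" "cofactor R i j \<noteq> 0" by blast
    have "real (card {A \<in> S i. zero_row i A = R}) \<le> (\<Prod>j<?N. if cofactor R i j = 0 then ?P else ?K)"
      using R by (intro fiber1 i) (simp add: zero_row_mats_def)
    also have "\<dots> = ?K * (\<Prod>j\<in>{..<?N} - {j}. if cofactor R i j = 0 then ?P else ?K)"
      using j by (subst prod.remove[of _ j]) auto
    also have "\<dots> \<le> ?K * (\<Prod>j\<in>{..<?N} - {j}. ?P)"
      using K0 P0 KP by (intro mult_left_mono prod_mono) auto
    also have "\<dots> = ?K * ?P ^ n" using j by simp
    finally show ?thesis .
  next
    case False
    have Rc: "R \<in> carrier_mat ?N ?N" using R by (simp add: zero_row_mats_def height_mats_def)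
    have "det R = 0"
      using laplace_expansion_row[OF Rc i] R by (simp add: zero_row_mats_def)
    \<comment> \<open>The erased row makes \<open>R\<close> singular. Its kernel vector
      \<open>w\<close> depends on \<open>R\<close> alone, so a single hyperplane contains row
      \<open>i\<close> of every matrix in the fibre.\<close>
    then obtain w where w: "\<exists>c<?N. w c \<noteq> 0" "\<And>r. r < ?N \<Longrightarrow> (\<Sum>c<?N. R $$ (r, c) * w c) = 0"
      using singular_kernel[OF Rc] by metis
    obtain j where j: "j < ?N" "w j \<noteq> 0" using w(1) by blast
    let ?X = "{x \<in> {..<?N} \<rightarrow>\<^sub>E ?F. (\<Sum>c<?N. x c * w c) = 0}"
    have "card {A \<in> S i. zero_row i A = R} \<le> card ?X"
    proof (rule fiber[OF i fin_fun])
      fix A assume A: "A \<in> S i" "zero_row i A = R"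
      have "cofactor A i j = 0" if "j < ?N" for j
        using False that cofactor_zero_row[OF Sc(1)[OF A(1)] i that] A(2) by simp
      \<comment> \<open>As all cofactors along row \<open>i\<close> vanish, membership in
        \<open>S i\<close> can only come from the row relation.\<close>
      then obtain v where v: "v i \<noteq> 0" "\<And>c. c < ?N \<Longrightarrow> (\<Sum>r<?N. v r * A $$ (r, c)) = 0"
        using A(1) by (auto simp: S_def)
      have "(\<Sum>c<?N. A $$ (i, c) * w c) = 0"
      proof (rule row_orthogonal_kernel[where v = v and a = "\<lambda>r c. A $$ (r, c)", OF i v])
        fix r assume r: "r < ?N" "r \<noteq> i"
        have "(\<Sum>c<?N. A $$ (r, c) * w c) = (\<Sum>c<?N. R $$ (r, c) * w c)"
          using zero_row_index[OF Sc(1)[OF A(1)] r(1), of _ i] r(2) A(2) by (intro sum.cong) auto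
        then show "(\<Sum>c<?N. A $$ (r, c) * w c) = 0" using w(2)[OF r(1)] by simp
      qed
      moreover have "(\<Sum>c<?N. restrict (\<lambda>j. A $$ (i, j)) {..<?N} c * w c) = (\<Sum>c<?N. A $$ (i, c) * w c)"
        by (intro sum.cong) auto
      ultimately show "restrict (\<lambda>j. A $$ (i, j)) {..<?N} \<in> ?X" using row_in[OF A(1) i] by simp
    qed
    also have "\<dots> \<le> card ?F ^ n"
      using card_hyperplane_le[where w = w and F = ?F, OF finite_height_fractions j] by (simp only: diff_Suc_1)
    finally have "real (card {A \<in> S i. zero_row i A = R}) \<le> real (card ?F ^ n)" by (simp only: of_nat_le_iff)
    also have "\<dots> \<le> ?P ^ n" by (rule Fpow)
    also have "\<dots> \<le> ?K * ?P ^ n" using K1 P0 mult_right_mono[of 1 ?K "?P ^ n"] by simp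
    finally show ?thesis .
  qed
  have Si: "real (card (S i)) \<le> ?P ^ (n * ?N) * ?K ^ ?N + real ?N * (b * ?P ^ n) * (?K * ?P ^ n)"
    if i: "i < ?N" for i
  proof -
    let ?V = "zero_row_mats ?N H i"
    \<comment> \<open>Erased matrices are split by whether some cofactor along row \<open>i\<close>
      vanishes. The union over \<open>j\<close> is bounded through singular minors; for the rest the
      count of all erased matrices is enough.\<close>
    let ?Vsing = "\<Union>j<?N. {R \<in> ?V. cofactor R i j = 0}"
    let ?Vreg = "{R \<in> ?V. \<forall>j<?N. cofactor R i j \<noteq> 0}"
    let ?Ssing = "{A \<in> S i. zero_row i A \<in> ?Vsing}" and ?Sreg = "{A \<in> S i. zero_row i A \<in> ?Vreg}"
    have finV: "finite ?V"
      by (rule finite_subset[OF _ finite_height_mats[of ?N H]]) (auto simp: zero_row_mats_def)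
    have "zero_row i A \<in> ?V" if A: "A \<in> S i" for A
      using zero_row_height_mats[OF H Sc(2)[OF A], of i] zero_row_index[OF Sc(1)[OF A] i, of _ i]
      by (simp add: zero_row_mats_def)
    then have "S i = ?Sreg \<union> ?Ssing" by auto
    then have "card (S i) = card (?Sreg \<union> ?Ssing)" by (rule arg_cong)
    also have "\<dots> \<le> card ?Sreg + card ?Ssing" by (rule card_Un_le)
    finally have split: "real (card (S i)) \<le> real (card ?Sreg) + real (card ?Ssing)" by linarith
    have "real (card ?Sreg) \<le> real (card ?Vreg) * ?K ^ ?N"
    proof (rule card_le_card_mult_fibers[where f = "zero_row i"])
      fix R assume R: "R \<in> ?Vreg"
      have "{A \<in> ?Sreg. zero_row i A = R} = {A \<in> S i. zero_row i A = R}" using R by auto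
      moreover have "(\<Prod>j<?N. if cofactor R i j = 0 then ?P else ?K) = (\<Prod>j<?N. ?K)"
        using R by (intro prod.cong) auto
      ultimately show "real (card {A \<in> ?Sreg. zero_row i A = R}) \<le> ?K ^ ?N"
        using fiber1[OF i, of R] R by (simp add: zero_row_mats_def)
    qed (use finV finS in auto)
    also have "\<dots> \<le> ?P ^ (n * ?N) * ?K ^ ?N"
    proof (intro mult_right_mono)
      have "card ?Vreg \<le> card ?V" using finV by (intro card_mono) auto
      also have "\<dots> \<le> card ?F ^ (n * ?N)" by (rule card_zero_row_mats_le[OF i])
      finally have "real (card ?Vreg) \<le> real (card ?F ^ (n * ?N))" by (simp only: of_nat_le_iff)
      then show "real (card ?Vreg) \<le> ?P ^ (n * ?N)" using Fpow[of "n * ?N"] by linarith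
    qed (use K0 in simp)
    finally have S1: "real (card ?Sreg) \<le> ?P ^ (n * ?N) * ?K ^ ?N" .
    have "real (card ?Ssing) \<le> real (card ?Vsing) * (?K * ?P ^ n)"
    proof (rule card_le_card_mult_fibers[where f = "zero_row i"])
      fix R assume R: "R \<in> ?Vsing"
      have "{A \<in> ?Ssing. zero_row i A = R} = {A \<in> S i. zero_row i A = R}" using R by auto
      then show "real (card {A \<in> ?Ssing. zero_row i A = R}) \<le> ?K * ?P ^ n"
        using fiber2[OF i, of R] R by auto
    qed (use finV finS in auto)
    also have "\<dots> \<le> (real ?N * (b * ?P ^ n)) * (?K * ?P ^ n)"
    proof (intro mult_right_mono)
      have "card ?Vsing \<le> (\<Sum>j<?N. card {R \<in> ?V. cofactor R i j = 0})" by (intro card_UN_le) simp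
      also have "\<dots> \<le> (\<Sum>j<?N. card (height_det_mats n H 0) * card ?F ^ n)"
        using i by (intro sum_mono card_zero_row_mats_cofactor_le) auto
      finally have "real (card ?Vsing) \<le> real (?N * (card (height_det_mats n H 0) * card ?F ^ n))"
        by (simp only: of_nat_le_iff sum_constant card_lessThan of_nat_id)
      also have "\<dots> = real ?N * (real (card (height_det_mats n H 0)) * real (card ?F ^ n))"
        by (simp only: of_nat_mult)
      also have "\<dots> \<le> real ?N * (b * ?P ^ n)"
        using b Fpow by (intro mult_left_mono mult_mono) auto
      finally show "real (card ?Vsing) \<le> real ?N * (b * ?P ^ n)" .
    qed (use K0 P0 in simp)
    finally show ?thesis using S1 split by linarith
  qed
  have "card (height_det_mats ?N H \<delta>) \<le> card (\<Union>i<?N. S i)"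
    using cover finS by (intro card_mono) auto
  also have "\<dots> \<le> (\<Sum>i<?N. card (S i))" by (intro card_UN_le) simp
  finally have "real (card (height_det_mats ?N H \<delta>)) \<le> (\<Sum>i<?N. real (card (S i)))"
    by (simp only: of_nat_le_iff flip: of_nat_sum)
  also have "\<dots> \<le> (\<Sum>i<?N. ?P ^ (n * ?N) * ?K ^ ?N + real ?N * (b * ?P ^ n) * (?K * ?P ^ n))"
    using Si by (intro sum_mono) auto
  also have "\<dots> = real ?N * (?P ^ (n * ?N) * ?K ^ ?N + real ?N * (b * ?P ^ n) * (?K * ?P ^ n))"
    by (simp only: sum_constant card_lessThan)
  finally show ?thesis .
qed

lemma powr_power_eq:
  fixes H :: real
  assumes "H > 0"
  shows "(c * H powr a * H ^ j) ^ k = c ^ k * H powr (real k * (a + real j))"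
proof -
  have "(H powr a * H ^ j) ^ k = (H powr (a + real j)) ^ k"
    using assms by (simp add: powr_add powr_realpow)
  also have "\<dots> = H powr (real k * (a + real j))"
    by (induction k) (use assms in \<open>simp_all add: distrib_right powr_add\<close>)
  finally show ?thesis by (simp only: power_mult_distrib mult.assoc)
qed

text \<open>Both terms of the inductive step have the same main exponent. With
  \<open>N = n + 1\<close> the first gives \<open>2 * n * N + N\<close> and the second
  \<open>(2 * n^2 - n) + 2 * n + 1 + 2 * n\<close>; each equals \<open>2 * N^2 - N\<close>. In
  dimension 2 this yields only the exponent 6, so the exponent 4 requires a separate
  argument.\<close>

lemma card_height_det_mats_le:
  fixes \<epsilon> :: real
  assumes "\<epsilon> > 0"
  shows "\<exists>C>0. \<forall>H\<ge>1. \<forall>\<delta>. real (card (height_det_mats n H \<delta>)) \<le> C * H powr (2 * (real n)\<^sup>2 - real n + \<epsilon>)"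
  using assms
proof (induction n arbitrary: \<epsilon>)
  case 0
  have "real (card (height_det_mats 0 H \<delta>)) \<le> 1 * H powr \<epsilon>" if "H \<ge> 1" for H \<delta>
  proof -
    have "height_det_mats 0 H \<delta> \<subseteq> {1\<^sub>m 0}"
      by (auto simp: height_det_mats_def height_mats_def)
    then have "card (height_det_mats 0 H \<delta>) \<le> card {1\<^sub>m 0 :: rat mat}" by (intro card_mono) auto
    moreover have "H powr \<epsilon> \<ge> 1" using that 0 by (simp add: ge_one_powr_ge_zero)
    ultimately show ?thesis by simp
  qed
  then show ?case by (intro exI[of _ 1]) simp
next
  case (Suc n)
  let ?N = "real (Suc n)"
  \<comment> \<open>The first term carries \<open>(Suc n)\<^sup>2\<close> factors
    \<open>H powr \<eta>\<close>; the second carries \<open>2 * n + 1\<close>, which is no more, on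
    top of the \<open>\<epsilon> / 2\<close> inherited from dimension \<open>n\<close>.\<close>
  define \<eta> where "\<eta> = \<epsilon> / (2 * ?N\<^sup>2)"
  have \<eta>: "\<eta> > 0" "?N\<^sup>2 * \<eta> = \<epsilon> / 2" using Suc.prems by (simp_all add: \<eta>_def)
  obtain L where L: "L \<ge> 3"
    and rows: "\<And>H R i \<delta>. H \<ge> 1 \<Longrightarrow> R \<in> height_mats (Suc n) H \<Longrightarrow> i < Suc n \<Longrightarrow>
      real (card {x \<in> {..<Suc n} \<rightarrow>\<^sub>E height_fractions H. (\<Sum>j<Suc n. x j * cofactor R i j) = \<delta>})
        \<le> (\<Prod>j<Suc n. if cofactor R i j = 0 then L * H powr \<eta> * H\<^sup>2 else L * H powr \<eta> * H)"
    using card_rows_le[OF \<eta>(1), of "Suc n"] by blast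
  obtain b where b: "b > 0" "\<And>H \<delta>. H \<ge> 1 \<Longrightarrow>
      real (card (height_det_mats n H \<delta>)) \<le> b * H powr (2 * (real n)\<^sup>2 - real n + \<epsilon> / 2)"
    using Suc.IH[of "\<epsilon> / 2"] Suc.prems by auto
  let ?e = "2 * ?N\<^sup>2 - ?N + \<epsilon>"
  define C where "C = ?N * (L ^ (n * Suc n + Suc n) + ?N * b * L ^ (n + 1 + n))"
  have "real (card (height_det_mats (Suc n) H \<delta>)) \<le> C * H powr ?e" if H: "H \<ge> 1" for H \<delta>
  proof -
    let ?L = "L * H powr \<eta>"
    have H0: "H > 0" using H by simp
    have "H powr \<eta> \<ge> 1" using H \<eta>(1) by (simp add: ge_one_powr_ge_zero)
    then have L3: "?L \<ge> 3" using mult_mono[of 3 L 1 "H powr \<eta>"] L by simp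
    have P: "(?L * H\<^sup>2) ^ k = L ^ k * H powr (real k * (\<eta> + 2))" for k
      using powr_power_eq[OF H0, of L \<eta> 2 k] by simp
    have K: "(?L * H) ^ k = L ^ k * H powr (real k * (\<eta> + 1))" for k
      using powr_power_eq[OF H0, of L \<eta> 1 k] by simp
    have K1: "?L * H = L * H powr (\<eta> + 1)" using H0 by (simp add: powr_add)
    have "(?L * H\<^sup>2) ^ (n * Suc n) * (?L * H) ^ Suc n
        = L ^ (n * Suc n + Suc n) * H powr (real (n * Suc n) * (\<eta> + 2) + ?N * (\<eta> + 1))"
      unfolding P K by (simp only: power_add powr_add ac_simps)
    also have "real (n * Suc n) * (\<eta> + 2) + ?N * (\<eta> + 1) = ?N\<^sup>2 * \<eta> + (2 * ?N\<^sup>2 - ?N)"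
      by (simp add: power2_eq_square algebra_simps)
    also have "L ^ (n * Suc n + Suc n) * H powr (?N\<^sup>2 * \<eta> + (2 * ?N\<^sup>2 - ?N))
        \<le> L ^ (n * Suc n + Suc n) * H powr ?e"
      unfolding \<eta>(2) using H L Suc.prems by (intro mult_left_mono powr_mono) auto
    finally have 1: "(?L * H\<^sup>2) ^ (n * Suc n) * (?L * H) ^ Suc n \<le> L ^ (n * Suc n + Suc n) * H powr ?e" .
    let ?b = "b * H powr (2 * (real n)\<^sup>2 - real n + \<epsilon> / 2)"
    have "?N * (?b * (?L * H\<^sup>2) ^ n) * (?L * H * (?L * H\<^sup>2) ^ n)
        = ?N * b * L ^ (n + 1 + n) * H powr ((2 * (real n)\<^sup>2 - real n + \<epsilon> / 2) + real n * (\<eta> + 2) + (\<eta> + 1) + real n * (\<eta> + 2))"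
      unfolding P K1 by (simp only: power_add power_one_right powr_add ac_simps)
    also have "(2 * (real n)\<^sup>2 - real n + \<epsilon> / 2) + real n * (\<eta> + 2) + (\<eta> + 1) + real n * (\<eta> + 2)
        = 2 * ?N\<^sup>2 - ?N + \<epsilon> / 2 + (2 * real n + 1) * \<eta>"
      by (simp add: power2_eq_square algebra_simps)
    also have "?N * b * L ^ (n + 1 + n) * H powr (2 * ?N\<^sup>2 - ?N + \<epsilon> / 2 + (2 * real n + 1) * \<eta>)
        \<le> ?N * b * L ^ (n + 1 + n) * H powr ?e"
    proof (intro mult_left_mono powr_mono)
      have "(2 * real n + 1) * \<eta> \<le> ?N\<^sup>2 * \<eta>"
        using \<eta>(1) by (intro mult_right_mono) (auto simp: power2_eq_square algebra_simps)
      then show "2 * ?N\<^sup>2 - ?N + \<epsilon> / 2 + (2 * real n + 1) * \<eta> \<le> ?e" using \<eta>(2) by linarith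
    qed (use H L b(1) in auto)
    finally have 2: "?N * (?b * (?L * H\<^sup>2) ^ n) * (?L * H * (?L * H\<^sup>2) ^ n) \<le> ?N * b * L ^ (n + 1 + n) * H powr ?e" .
    have "real (card (height_det_mats (Suc n) H \<delta>))
        \<le> ?N * ((?L * H\<^sup>2) ^ (n * Suc n) * (?L * H) ^ Suc n + ?N * (?b * (?L * H\<^sup>2) ^ n) * (?L * H * (?L * H\<^sup>2) ^ n))"
      by (intro card_height_det_mats_Suc_le H L3 rows b(2))
    also have "\<dots> \<le> ?N * (L ^ (n * Suc n + Suc n) * H powr ?e + ?N * b * L ^ (n + 1 + n) * H powr ?e)"
      by (intro mult_left_mono add_mono 1 2) simp
    also have "\<dots> = C * H powr ?e" by (simp only: C_def distrib_right mult.assoc)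
    finally show ?thesis .
  qed
  moreover have "C > 0" unfolding C_def using L b(1) by (intro mult_pos_pos add_pos_pos) auto
  ultimately show ?case by blast
qed

section \<open>Two by two matrices and multiplicative collisions\<close>

text \<open>
  With \<open>r \<mu>\<close> the number of representations of \<open>\<mu>\<close>, the left-hand side is \<open>\<Sum> r \<mu> * r (\<mu> + \<delta>)\<close>,
  which Cauchy-Schwarz bounds by the case \<open>\<delta> = 0\<close>.
\<close>
lemma card_shifted_collisions_le:
  fixes f :: "'a \<Rightarrow> 'b::ab_group_add"
  assumes fin: "finite S"
  shows "card {(p, q). p \<in> S \<and> q \<in> S \<and> f p = f q + \<delta>} \<le> card {(p, q). p \<in> S \<and> q \<in> S \<and> f p = f q}"
proof -
  define r where "r \<mu> = card {p \<in> S. f p = \<mu>}" for \<mu>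
  let ?T = "f ` S"
  have r0: "r \<mu> = 0" if "\<mu> \<notin> ?T" for \<mu>
  proof -
    have "{p \<in> S. f p = \<mu>} = {}" using that by auto
    then show ?thesis by (simp only: r_def card.empty)
  qed
  have count: "card {(p, q). p \<in> S \<and> q \<in> S \<and> f p = f q + d} = (\<Sum>\<mu>\<in>?T. r \<mu> * r (\<mu> + d))" for d
  proof -
    have "{(p, q). p \<in> S \<and> q \<in> S \<and> f p = f q + d} = prod.swap ` (SIGMA q:S. {p \<in> S. f p = f q + d})" by auto
    then have "card {(p, q). p \<in> S \<and> q \<in> S \<and> f p = f q + d} = card (SIGMA q:S. {p \<in> S. f p = f q + d})"
      by (simp only: card_image inj_swap)
    also have "\<dots> = (\<Sum>q\<in>S. r (f q + d))" using fin by (simp add: r_def)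
    also have "\<dots> = (\<Sum>\<mu>\<in>?T. \<Sum>q\<in>{q \<in> S. f q = \<mu>}. r (f q + d))"
      by (rule sum.image_gen[OF fin])
    also have "\<dots> = (\<Sum>\<mu>\<in>?T. \<Sum>q\<in>{q \<in> S. f q = \<mu>}. r (\<mu> + d))"
      by (intro sum.cong) auto
    also have "\<dots> = (\<Sum>\<mu>\<in>?T. r \<mu> * r (\<mu> + d))" by (simp add: r_def)
    finally show ?thesis .
  qed
  \<comment> \<open>Shifting may move points of \<open>?T\<close> outside \<open>?T\<close>, but
    \<open>r\<close> vanishes there by \<open>r0\<close>, so the sum of squares cannot grow.\<close>
  have "(\<Sum>\<mu>\<in>?T. (r (\<mu> + \<delta>))\<^sup>2) = (\<Sum>\<nu>\<in>(\<lambda>\<mu>. \<mu> + \<delta>) ` ?T. (r \<nu>)\<^sup>2)"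
    by (subst sum.reindex) (auto simp: inj_on_def)
  also have "\<dots> \<le> (\<Sum>\<nu>\<in>?T \<union> (\<lambda>\<mu>. \<mu> + \<delta>) ` ?T. (r \<nu>)\<^sup>2)"
    using fin by (intro sum_mono2) auto
  also have "\<dots> = (\<Sum>\<nu>\<in>?T. (r \<nu>)\<^sup>2)"
    using fin r0 by (intro sum.mono_neutral_right) auto
  finally have shift: "(\<Sum>\<mu>\<in>?T. (r (\<mu> + \<delta>))\<^sup>2) \<le> (\<Sum>\<mu>\<in>?T. (r \<mu>)\<^sup>2)" .
  \<comment> \<open>Cauchy-Schwarz is used in the form
    \<open>2 * a * b \<le> a\<^sup>2 + b\<^sup>2\<close>, which keeps all sums in the natural
    numbers.\<close>
  have "2 * (\<Sum>\<mu>\<in>?T. r \<mu> * r (\<mu> + \<delta>)) = (\<Sum>\<mu>\<in>?T. 2 * r \<mu> * r (\<mu> + \<delta>))"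
    by (simp add: sum_distrib_left mult.assoc)
  also have "\<dots> \<le> (\<Sum>\<mu>\<in>?T. (r \<mu>)\<^sup>2 + (r (\<mu> + \<delta>))\<^sup>2)"
  proof (rule sum_mono)
    fix \<mu>
    have "real (2 * r \<mu> * r (\<mu> + \<delta>)) \<le> real ((r \<mu>)\<^sup>2 + (r (\<mu> + \<delta>))\<^sup>2)"
      using sum_squares_bound[of "real (r \<mu>)" "real (r (\<mu> + \<delta>))"] by simp
    then show "2 * r \<mu> * r (\<mu> + \<delta>) \<le> (r \<mu>)\<^sup>2 + (r (\<mu> + \<delta>))\<^sup>2" by (simp only: of_nat_le_iff)
  qed
  also have "\<dots> \<le> 2 * (\<Sum>\<mu>\<in>?T. (r \<mu>)\<^sup>2)" using shift by (simp add: sum.distrib)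
  finally have "(\<Sum>\<mu>\<in>?T. r \<mu> * r (\<mu> + \<delta>)) \<le> (\<Sum>\<mu>\<in>?T. (r \<mu>)\<^sup>2)" by simp
  then show ?thesis using count[of \<delta>] count[of 0] by (simp add: power2_eq_square)
qed

text \<open>A pair with product 0 contains a 0, so collisions at 0 number at most
  \<open>36 * H ^ 4\<close>. For a nonzero product, four of the eight numerators and denominators
  range over at most \<open>9 * H ^ 4\<close> values, and the other four divide a known nonzero
  integer.\<close>

lemma card_product_collisions_le:
  fixes \<epsilon> :: real
  assumes "\<epsilon> > 0"
  shows "\<exists>C>0. \<forall>H\<ge>1. real (card {(p, q). p \<in> height_fractions H \<times> height_fractions H \<and>
      q \<in> height_fractions H \<times> height_fractions H \<and> fst p * snd p = fst q * snd q}) \<le> C * H powr (4 + \<epsilon>)"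
proof -
  \<comment> \<open>That integer is at most \<open>H ^ 4\<close> in absolute value and four of its
    divisors are chosen, so \<open>\<epsilon> / 16\<close> leads to a total of
    \<open>H powr \<epsilon>\<close>.\<close>
  obtain C0 where C0: "C0 > 0"
    and div: "\<And>m::int. m \<noteq> 0 \<Longrightarrow> real (card {d. d dvd m}) \<le> C0 * \<bar>real_of_int m\<bar> powr (\<epsilon> / 16)"
    using divisor_bound[of "\<epsilon> / 16"] assms by auto
  have "real (card {(p, q). p \<in> height_fractions H \<times> height_fractions H \<and>
      q \<in> height_fractions H \<times> height_fractions H \<and> fst p * snd p = fst q * snd q}) \<le> (36 + 9 * C0 ^ 4) * H powr (4 + \<epsilon>)"
    if H: "H \<ge> 1" for H
  proof -
    let ?F = "height_fractions H" and ?h = "\<lfloor>H\<rfloor>"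
    let ?Q = "{(p, q). p \<in> ?F \<times> ?F \<and> q \<in> ?F \<times> ?F \<and> fst p * snd p = fst q * snd q}"
    let ?Z = "{p \<in> ?F \<times> ?F. fst p * snd p = 0}"
    let ?W = "{pq \<in> ?Q. fst (fst pq) * snd (fst pq) \<noteq> 0}"
    have finF: "finite ?F" by (rule finite_height_fractions)
    have finQ: "finite ?Q"
      by (rule finite_subset[of _ "(?F \<times> ?F) \<times> (?F \<times> ?F)"]) (auto simp: finF)
    have h: "?h \<ge> 1" "real_of_int ?h \<le> H" using H by (simp_all add: le_floor_iff)
    have "?Z \<subseteq> ({0} \<times> ?F) \<union> (?F \<times> {0})" by auto
    then have "card ?Z \<le> card (({0} \<times> ?F) \<union> (?F \<times> {0}))" using finF by (intro card_mono) auto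
    also have "\<dots> \<le> card ({0::rat} \<times> ?F) + card (?F \<times> {0::rat})" by (rule card_Un_le)
    finally have "real (card ?Z) \<le> 2 * real (card ?F)" by (simp add: card_cartesian_product)
    then have "real (card ?Z) \<le> 6 * H\<^sup>2" using card_height_fractions_le[OF H] by linarith
    then have "real (card ?Z) * real (card ?Z) \<le> (6 * H\<^sup>2) * (6 * H\<^sup>2)" by (intro mult_mono) auto
    then have Z: "real (card (?Z \<times> ?Z)) \<le> 36 * H ^ 4"
      by (simp add: card_cartesian_product power2_eq_square power4_eq_xxxx)
    \<comment> \<open>Clearing denominators in \<open>x * x' = z * z'\<close> turns a nonzero collision into an equality of two
      products of four integers, so one side leaves only divisors of its value for the other.\<close>
    let ?f = "\<lambda>pq. (rat_num (fst (fst pq)), rat_num (snd (fst pq)), rat_den (fst (snd pq)), rat_den (snd (snd pq)))"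
    let ?g = "\<lambda>pq. (rat_num (fst (snd pq)), rat_num (snd (snd pq)), rat_den (fst (fst pq)), rat_den (snd (fst pq)))"
    let ?B = "{-?h..?h} \<times> {-?h..?h} \<times> {1..?h} \<times> {1..?h}"
    have nd: "- ?h \<le> rat_num x" "rat_num x \<le> ?h" "1 \<le> rat_den x" "rat_den x \<le> ?h" if "x \<in> ?F" for x
    proof -
      have *: "\<bar>real_of_int (rat_num x)\<bar> \<le> H" "real_of_int (rat_den x) \<le> H"
        using that by (auto simp: height_fractions_iff)
      have "rat_num x \<le> ?h" "- rat_num x \<le> ?h" "rat_den x \<le> ?h"
        using * unfolding le_floor_iff by linarith+
      then show "- ?h \<le> rat_num x" "rat_num x \<le> ?h" "1 \<le> rat_den x" "rat_den x \<le> ?h"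
        using rat_den_pos[of x] by linarith+
    qed
    define D where "D = C0 * H powr (\<epsilon> / 4)"
    have "real (card ?W) \<le> real (card ?B) * D ^ 4"
    proof (rule card_le_card_mult_fibers[where f = ?f])
      show "?f ` ?W \<subseteq> ?B" using nd by auto
      show "finite ?W" using finQ by simp
      fix y assume y: "y \<in> ?B"
      obtain a a' b b' where y_eq: "y = (a, a', b, b')" by (cases y) auto
      let ?fib = "{pq \<in> ?W. ?f pq = y}"
      let ?M = "a * a' * b * b'"
      have key: "?M \<noteq> 0 \<and> ?M = rat_num (fst (snd pq)) * rat_num (snd (snd pq)) * rat_den (fst (fst pq)) * rat_den (snd (fst pq))"
        if pq: "pq \<in> ?fib" for pq
      proof -
        obtain x x' z z' where pq_eq: "pq = ((x, x'), (z, z'))" by (metis surj_pair)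
        have ab: "rat_num x = a" "rat_num x' = a'" "rat_den z = b" "rat_den z' = b'"
          and eq: "x * x' = z * z'" and nz: "x * x' \<noteq> 0"
          using pq unfolding pq_eq y_eq by auto
        have pos: "rat_den x > 0" "rat_den x' > 0" "b > 0" "b' > 0"
          using rat_den_pos ab by metis+
        have x: "x = of_int a / of_int (rat_den x)" "x' = of_int a' / of_int (rat_den x')"
          "z = of_int (rat_num z) / of_int b" "z' = of_int (rat_num z') / of_int b'"
          using num_div_den[of x] num_div_den[of x'] num_div_den[of z] num_div_den[of z'] ab by simp_all
        have "of_int a / of_int (rat_den x) * (of_int a' / of_int (rat_den x'))
            = (of_int (rat_num z) / of_int b * (of_int (rat_num z') / of_int b') :: rat)"
          using eq by (simp only: x[symmetric])
        then have "(of_int ?M :: rat) = of_int (rat_num z * rat_num z' * rat_den x * rat_den x')"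
          using pos by (simp add: field_simps)
        then have "?M = rat_num z * rat_num z' * rat_den x * rat_den x'" by (simp only: of_int_eq_iff)
        moreover have "a \<noteq> 0" "a' \<noteq> 0" using nz x(1,2) by auto
        then have "?M \<noteq> 0" using pos by simp
        ultimately show ?thesis unfolding pq_eq fst_conv snd_conv by (rule conjI[rotated])
      qed
      show "real (card ?fib) \<le> D ^ 4"
      \<comment> \<open>For an empty fibre \<open>?M\<close> may be 0, which every integer divides;
        the divisor bound applies only to inhabited fibres.\<close>
      proof (cases "?fib = {}")
        case True
        then have "card ?fib = 0" by (simp only: card.empty)
        then show ?thesis using C0 by (simp add: D_def)
      next
        case False
        then have M0: "?M \<noteq> 0" using key by blast
        let ?V = "{d. d dvd ?M}"
        have finV: "finite ?V" using M0 by (rule finite_divisors_int)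
        have "card ?fib \<le> card (?V \<times> ?V \<times> ?V \<times> ?V)"
        proof (rule card_inj_on_le)
          \<comment> \<open>\<open>?f\<close> and \<open>?g\<close> together list all numerators and
            denominators, and \<open>?f\<close> is constant on the fibre.\<close>
          show "inj_on ?g ?fib"
            by (rule inj_onI) (auto simp: y_eq intro!: rat_eqI)
          show "?g ` ?fib \<subseteq> ?V \<times> ?V \<times> ?V \<times> ?V"
          proof
            fix t assume "t \<in> ?g ` ?fib"
            then obtain pq where pq: "pq \<in> ?fib" "t = ?g pq" by blast
            show "t \<in> ?V \<times> ?V \<times> ?V \<times> ?V" unfolding pq(2) using key[OF pq(1)] by simp
          qed
          show "finite (?V \<times> ?V \<times> ?V \<times> ?V)" using finV by simp
        qed
        then have "real (card ?fib) \<le> real (card ?V) ^ 4"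
          by (simp add: card_cartesian_product power4_eq_xxxx flip: of_nat_mult)
        also have "\<dots> \<le> D ^ 4"
        proof (intro power_mono)
          have "\<bar>real_of_int k\<bar> \<le> H" if "- ?h \<le> k" "k \<le> ?h" for k
          proof -
            have "real_of_int \<bar>k\<bar> \<le> real_of_int ?h" using that by (simp only: of_int_le_iff abs_le_iff) simp
            then show ?thesis using h(2) by linarith
          qed
          moreover have "- ?h \<le> a" "a \<le> ?h" "- ?h \<le> a'" "a' \<le> ?h" "- ?h \<le> b" "b \<le> ?h" "- ?h \<le> b'" "b' \<le> ?h"
            using y unfolding y_eq by simp_all
          ultimately have "\<bar>real_of_int a\<bar> \<le> H" "\<bar>real_of_int a'\<bar> \<le> H" "\<bar>real_of_int b\<bar> \<le> H" "\<bar>real_of_int b'\<bar> \<le> H"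
            by blast+
          then have "\<bar>real_of_int ?M\<bar> \<le> H * H * H * H"
            using H unfolding of_int_mult abs_mult by (intro mult_mono) auto
          then have "\<bar>real_of_int ?M\<bar> powr (\<epsilon> / 16) \<le> (H ^ 4) powr (\<epsilon> / 16)"
            using assms by (intro powr_mono2) (auto simp: power4_eq_xxxx)
          also have "(H ^ 4) powr (\<epsilon> / 16) = H powr (\<epsilon> / 4)"
            using H by (simp add: powr_powr flip: powr_numeral)
          finally have "C0 * \<bar>real_of_int ?M\<bar> powr (\<epsilon> / 16) \<le> D"
            unfolding D_def using C0 by (intro mult_left_mono) auto
          then show "real (card ?V) \<le> D" using div[OF M0] by linarith
        qed simp
        finally show ?thesis .
      qed
    qed simp
    also have "\<dots> \<le> (9 * H ^ 4) * D ^ 4"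
    proof (intro mult_right_mono)
      have cube: "(2 * r + 1) * ((2 * r + 1) * (r * r)) \<le> (3 * H) * ((3 * H) * (H * H))"
        if "1 \<le> r" "r \<le> H" for r
        using that by (intro mult_mono) auto
      have "real (card ?B) = (2 * real_of_int ?h + 1) * ((2 * real_of_int ?h + 1) * (real_of_int ?h * real_of_int ?h))"
        using h by (simp add: card_cartesian_product)
      also have "\<dots> \<le> (3 * H) * ((3 * H) * (H * H))" by (rule cube) (use h in linarith)+
      finally show "real (card ?B) \<le> 9 * H ^ 4" by (simp add: power4_eq_xxxx)
    qed (use C0 in \<open>simp add: D_def\<close>)
    also have "D ^ 4 = C0 ^ 4 * H powr \<epsilon>"
      using powr_power_eq[of H C0 "\<epsilon> / 4" 0 4] H by (simp add: D_def)
    finally have W: "real (card ?W) \<le> 9 * H ^ 4 * (C0 ^ 4 * H powr \<epsilon>)" .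
    have "?Q \<subseteq> (?Z \<times> ?Z) \<union> ?W" by auto
    then have "card ?Q \<le> card ((?Z \<times> ?Z) \<union> ?W)" using finF finQ by (intro card_mono) auto
    also have "\<dots> \<le> card (?Z \<times> ?Z) + card ?W" by (rule card_Un_le)
    finally have "real (card ?Q) \<le> real (card (?Z \<times> ?Z)) + real (card ?W)" by linarith
    also have "\<dots> \<le> 36 * H ^ 4 * H powr \<epsilon> + 9 * H ^ 4 * (C0 ^ 4 * H powr \<epsilon>)"
    proof -
      have "36 * H ^ 4 * 1 \<le> 36 * H ^ 4 * H powr \<epsilon>"
        using H assms by (intro mult_left_mono ge_one_powr_ge_zero) auto
      then show ?thesis using Z W by linarith
    qed
    also have "\<dots> = (36 + 9 * C0 ^ 4) * (H ^ 4 * H powr \<epsilon>)" by (simp add: algebra_simps)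
    also have "H ^ 4 * H powr \<epsilon> = H powr (4 + \<epsilon>)" using H by (simp add: powr_add)
    finally show ?thesis .
  qed
  moreover have "36 + 9 * C0 ^ 4 > 0" using C0 by (intro add_pos_pos) auto
  ultimately show ?thesis by blast
qed

lemma det_2:
  fixes A :: "'a::comm_ring_1 mat"
  assumes A: "A \<in> carrier_mat 2 2"
  shows "det A = A $$ (0, 0) * A $$ (1, 1) - A $$ (0, 1) * A $$ (1, 0)"
proof -
  have "mat_delete A 0 j \<in> carrier_mat 1 1" for j
    using mat_delete_carrier[OF A] by simp
  then have "cofactor A 0 j = (-1) ^ j * mat_delete A 0 j $$ (0, 0)" for j
    by (simp only: cofactor_def det_single add_0)
  then have "cofactor A 0 0 = A $$ (1, 1)" "cofactor A 0 1 = - A $$ (1, 0)"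
    using A by (simp_all add: mat_delete_def)
  then show ?thesis
    using laplace_expansion_row[OF A, of 0] by (simp add: numeral_2_eq_2)
qed

text \<open>The diagonal product equals the antidiagonal product plus \<open>\<delta>\<close>, so
  these matrices are shifted collisions of the product map on pairs.\<close>

lemma card_height_det_mats_2_le:
  fixes \<epsilon> :: real
  assumes "\<epsilon> > 0"
  shows "\<exists>C>0. \<forall>H\<ge>1. \<forall>\<delta>. real (card (height_det_mats 2 H \<delta>)) \<le> C * H powr (4 + \<epsilon>)"
proof -
  obtain C where C: "C > 0" and coll: "\<And>H. H \<ge> 1 \<Longrightarrow>
    real (card {(p, q). p \<in> height_fractions H \<times> height_fractions H \<and>
      q \<in> height_fractions H \<times> height_fractions H \<and> fst p * snd p = fst q * snd q}) \<le> C * H powr (4 + \<epsilon>)"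
    using card_product_collisions_le[OF assms] by blast
  have "real (card (height_det_mats 2 H \<delta>)) \<le> C * H powr (4 + \<epsilon>)" if H: "H \<ge> 1" for H \<delta>
  proof -
    let ?S = "height_fractions H \<times> height_fractions H"
    let ?m = "\<lambda>p :: rat \<times> rat. fst p * snd p"
    let ?f = "\<lambda>A. ((A $$ (0, 0), A $$ (1, 1)), (A $$ (0, 1), A $$ (1, 0)))"
    have finS: "finite ?S" by (simp add: finite_height_fractions)
    have "card (height_det_mats 2 H \<delta>) \<le> card {(p, q). p \<in> ?S \<and> q \<in> ?S \<and> ?m p = ?m q + \<delta>}"
    proof (rule card_inj_on_le)
      show "inj_on ?f (height_det_mats 2 H \<delta>)"
      proof (rule inj_onI)
        fix A B assume A: "A \<in> height_det_mats 2 H \<delta>" and B: "B \<in> height_det_mats 2 H \<delta>" and eq: "?f A = ?f B"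
        have "A $$ (i, j) = B $$ (i, j)" if "i < 2" "j < 2" for i j
          using eq that by (auto simp: less_2_cases_iff)
        then show "A = B" using A B by (intro eq_matI) (auto simp: height_det_mats_def height_mats_def)
      qed
      show "?f ` height_det_mats 2 H \<delta> \<subseteq> {(p, q). p \<in> ?S \<and> q \<in> ?S \<and> ?m p = ?m q + \<delta>}"
      proof
        fix y assume "y \<in> ?f ` height_det_mats 2 H \<delta>"
        then obtain A where A: "A \<in> height_det_mats 2 H \<delta>" "y = ?f A" by blast
        have "A \<in> carrier_mat 2 2" using A(1) by (simp add: height_det_mats_def height_mats_def)
        then have "det A = A $$ (0, 0) * A $$ (1, 1) - A $$ (0, 1) * A $$ (1, 0)" by (rule det_2)
        then show "y \<in> {(p, q). p \<in> ?S \<and> q \<in> ?S \<and> ?m p = ?m q + \<delta>}"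
          using A by (auto simp: height_det_mats_def height_mats_def)
      qed
      show "finite {(p, q). p \<in> ?S \<and> q \<in> ?S \<and> ?m p = ?m q + \<delta>}"
        by (rule finite_subset[of _ "?S \<times> ?S"]) (use finS in auto)
    qed
    also have "\<dots> \<le> card {(p, q). p \<in> ?S \<and> q \<in> ?S \<and> ?m p = ?m q}"
      by (rule card_shifted_collisions_le[OF finS])
    finally show ?thesis using coll[OF H] by linarith
  qed
  with C show ?thesis by blast
qed

theorem theorem2p2:
  fixes n :: nat
  assumes "n \<ge> 2"
  shows "\<forall>\<epsilon>::real. \<epsilon> > 0 \<longrightarrow>
    (\<exists>H0::real. H0 \<ge> 1 \<and>
      (\<forall>H::real. H \<ge> H0 \<longrightarrow> (\<forall>\<delta>::rat.
        real (card (height_det_mats n H \<delta>)) \<le>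
          H powr ((if n = 2 then 4 else 2 * (real n)\<^sup>2 - real n) + \<epsilon>))))"
proof (intro allI impI)
  fix \<epsilon> :: real assume \<epsilon>: "\<epsilon> > 0"
  let ?c = "if n = 2 then 4 else 2 * (real n)\<^sup>2 - real n"
  obtain C where C: "C > 0"
    and bound: "\<And>H \<delta>. H \<ge> 1 \<Longrightarrow> real (card (height_det_mats n H \<delta>)) \<le> C * H powr (?c + \<epsilon> / 2)"
    using card_height_det_mats_2_le[of "\<epsilon> / 2"] card_height_det_mats_le[of "\<epsilon> / 2" n] \<epsilon>
    by (cases "n = 2") auto
  \<comment> \<open>From this point on \<open>C \<le> H powr (\<epsilon> / 2)\<close>: half of
    \<open>\<epsilon>\<close> absorbs the constant, the other half is already in
    \<open>bound\<close>. \<open>C\<close> does not depend on \<open>\<delta>\<close>, so neither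
    does \<open>H0\<close>.\<close>
  define H0 where "H0 = max 1 (C powr (2 / \<epsilon>))"
  have "real (card (height_det_mats n H \<delta>)) \<le> H powr (?c + \<epsilon>)" if H: "H \<ge> H0" for H \<delta>
  proof -
    have H1: "H \<ge> 1" and HC: "C powr (2 / \<epsilon>) \<le> H" using H by (auto simp: H0_def)
    have "C = (C powr (2 / \<epsilon>)) powr (\<epsilon> / 2)" using C \<epsilon> by (simp add: powr_powr)
    also have "\<dots> \<le> H powr (\<epsilon> / 2)" using HC \<epsilon> by (intro powr_mono2) auto
    finally have "C * H powr (?c + \<epsilon> / 2) \<le> H powr (\<epsilon> / 2) * H powr (?c + \<epsilon> / 2)"
      by (rule mult_right_mono) simp
    also have "\<dots> = H powr (\<epsilon> / 2 + (?c + \<epsilon> / 2))" by (rule powr_add[symmetric])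
    also have "\<epsilon> / 2 + (?c + \<epsilon> / 2) = ?c + \<epsilon>" by simp
    finally show ?thesis using bound[OF H1, of \<delta>] by linarith
  qed
  then show "\<exists>H0::real. H0 \<ge> 1 \<and> (\<forall>H::real. H \<ge> H0 \<longrightarrow> (\<forall>\<delta>::rat.
      real (card (height_det_mats n H \<delta>)) \<le> H powr (?c + \<epsilon>)))"
    by (intro exI[of _ H0]) (auto simp: H0_def)
qed

end
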